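(* Any right (or left) Hilbert C*-module $X$ over a C*-algebra $A$ admits a generalized right (or left) basis.
   Context: Let $X$ be a right Hilbert $A$-module. A generalized right basis of $X$ consists of a set $\Lambda$ and, for each finite subset $\mu\subset\Lambda$, a finite subset $u_\mu$ of $X$ with $|u_\mu|=|\mu|$, such that, ordering finite subsets of $\Lambda$ by inclusion, (1) for all $x\in X$, $\sum_{y\in u_\mu}(x|y)_A(y|x)_A\le\sum_{y\in u_\nu}(x|y)_A(y|x)_A$ if $\mu\subset\nu$; (2) for all $x\in X$, $x=\lim_\mu\sum_{y\in u_\mu}y(y|x)_A$ in norm. For a left Hilbert $A$-module with inner product ${}_A(\cdot|\cdot)$ a generalized left basis is defined symmetrically: $\sum_{y\in u_\mu}{}_A(x|y)\,{}_A(y|x)$ is increasing in $\mu$ and $x=\lim_\mu\sum_{y\in u_\mu}{}_A(x|y)y$ for all $x\in X$. *)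

theory Defs
  imports "HOL-Analysis.Analysis"
begin

class scaleC = scaleR +
  fixes scaleC :: "complex \<Rightarrow> 'a \<Rightarrow> 'a"  (infixr "*\<^sub>C" 75)

class complex_vector = real_vector + scaleC +
  assumes scaleC_add_right: "c *\<^sub>C (x + y) = c *\<^sub>C x + c *\<^sub>C y"
    and scaleC_add_left: "(c + d) *\<^sub>C x = c *\<^sub>C x + d *\<^sub>C x"
    and scaleC_scaleC: "c *\<^sub>C (d *\<^sub>C x) = (c * d) *\<^sub>C x"
    and scaleR_scaleC: "r *\<^sub>R x = complex_of_real r *\<^sub>C x"

class complex_normed_vector = complex_vector + real_normed_vector +
  assumes norm_scaleC: "norm (c *\<^sub>C x) = cmod c * norm x"

class cbanach = complex_normed_vector + complete_space

text \<open>No unit is assumed: \<^class>\<open>real_normed_algebra\<close> has a submultiplicative norm but no \<open>1\<close>,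
  and the zero algebra is allowed.\<close>

class cstar_algebra = cbanach + real_normed_algebra +
  fixes star :: "'a \<Rightarrow> 'a"
  assumes mult_scaleC_left: "(c *\<^sub>C a) * b = c *\<^sub>C (a * b)"
    and mult_scaleC_right: "a * (c *\<^sub>C b) = c *\<^sub>C (a * b)"
    and star_add: "star (a + b) = star a + star b"
    and star_scaleC: "star (c *\<^sub>C a) = cnj c *\<^sub>C star a"
    and star_mult: "star (a * b) = star b * star a"
    and star_star: "star (star a) = a"
    and norm_star_mult_self: "norm (star a * a) = (norm a)\<^sup>2"

definition cstar_positive :: "'a::cstar_algebra \<Rightarrow> bool" where
  "cstar_positive a \<longleftrightarrow> (\<exists>c. a = star c * c)"

definition cstar_le :: "'a::cstar_algebra \<Rightarrow> 'a \<Rightarrow> bool"  (infix "\<le>\<^sub>A" 50) where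
  "a \<le>\<^sub>A b \<longleftrightarrow> cstar_positive (b - a)"

text \<open>The norm of the underlying Banach space is required to be the one induced by the inner
  product, so completeness of the module in the induced norm is the completeness contained in
  \<^class>\<open>cbanach\<close>. The \<open>A\<close>-valued inner product of a right module is linear in its second
  argument, that of a left module in its first.\<close>

locale right_hilbert_module =
  fixes act :: "'x::cbanach \<Rightarrow> 'a::cstar_algebra \<Rightarrow> 'x"  (infixl "\<cdot>" 70)
    and ip :: "'x \<Rightarrow> 'x \<Rightarrow> 'a"
  assumes act_add_left: "(x + y) \<cdot> a = x \<cdot> a + y \<cdot> a"
    and act_add_right: "x \<cdot> (a + b) = x \<cdot> a + x \<cdot> b"
    and act_mult: "x \<cdot> (a * b) = (x \<cdot> a) \<cdot> b"
    and act_scaleC_left: "(c *\<^sub>C x) \<cdot> a = c *\<^sub>C (x \<cdot> a)"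
    and act_scaleC_right: "x \<cdot> (c *\<^sub>C a) = c *\<^sub>C (x \<cdot> a)"
    and ip_add_right: "ip x (y + z) = ip x y + ip x z"
    and ip_scaleC_right: "ip x (c *\<^sub>C y) = c *\<^sub>C ip x y"
    and ip_act_right: "ip x (y \<cdot> a) = ip x y * a"
    and star_ip: "star (ip x y) = ip y x"
    and ip_positive: "cstar_positive (ip x x)"
    and ip_definite: "ip x x = 0 \<Longrightarrow> x = 0"
    and norm_ip: "norm x = sqrt (norm (ip x x))"

locale left_hilbert_module =
  fixes act :: "'a::cstar_algebra \<Rightarrow> 'x::cbanach \<Rightarrow> 'x"  (infixr "\<cdot>" 70)
    and ip :: "'x \<Rightarrow> 'x \<Rightarrow> 'a"
  assumes act_add_right: "a \<cdot> (x + y) = a \<cdot> x + a \<cdot> y"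
    and act_add_left: "(a + b) \<cdot> x = a \<cdot> x + b \<cdot> x"
    and act_mult: "(a * b) \<cdot> x = a \<cdot> (b \<cdot> x)"
    and act_scaleC_right: "a \<cdot> (c *\<^sub>C x) = c *\<^sub>C (a \<cdot> x)"
    and act_scaleC_left: "(c *\<^sub>C a) \<cdot> x = c *\<^sub>C (a \<cdot> x)"
    and ip_add_left: "ip (x + y) z = ip x z + ip y z"
    and ip_scaleC_left: "ip (c *\<^sub>C x) y = c *\<^sub>C ip x y"
    and ip_act_left: "ip (a \<cdot> x) y = a * ip x y"
    and star_ip: "star (ip x y) = ip y x"
    and ip_positive: "cstar_positive (ip x x)"
    and ip_definite: "ip x x = 0 \<Longrightarrow> x = 0"
    and norm_ip: "norm x = sqrt (norm (ip x x))"

text \<open>The families \<open>u\<close> are only constrained on finite subsets of \<open>\<Lambda>\<close>; the limit is taken along the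
  net of these subsets, directed by inclusion.\<close>

definition generalized_right_basis ::
    "('x::cbanach \<Rightarrow> 'a::cstar_algebra \<Rightarrow> 'x) \<Rightarrow> ('x \<Rightarrow> 'x \<Rightarrow> 'a) \<Rightarrow> 'i set \<Rightarrow> ('i set \<Rightarrow> 'x set) \<Rightarrow> bool"
  where "generalized_right_basis act ip \<Lambda> u \<longleftrightarrow>
    (\<forall>\<mu>. finite \<mu> \<and> \<mu> \<subseteq> \<Lambda> \<longrightarrow> finite (u \<mu>) \<and> card (u \<mu>) = card \<mu>) \<and>
    (\<forall>x \<mu> \<nu>. finite \<nu> \<and> \<mu> \<subseteq> \<nu> \<and> \<nu> \<subseteq> \<Lambda> \<longrightarrow>
      (\<Sum>y\<in>u \<mu>. ip x y * ip y x) \<le>\<^sub>A (\<Sum>y\<in>u \<nu>. ip x y * ip y x)) \<and>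
    (\<forall>x. ((\<lambda>\<mu>. \<Sum>y\<in>u \<mu>. act y (ip y x)) \<longlongrightarrow> x) (finite_subsets_at_top \<Lambda>))"

definition generalized_left_basis ::
    "('a::cstar_algebra \<Rightarrow> 'x::cbanach \<Rightarrow> 'x) \<Rightarrow> ('x \<Rightarrow> 'x \<Rightarrow> 'a) \<Rightarrow> 'i set \<Rightarrow> ('i set \<Rightarrow> 'x set) \<Rightarrow> bool"
  where "generalized_left_basis act ip \<Lambda> u \<longleftrightarrow>
    (\<forall>\<mu>. finite \<mu> \<and> \<mu> \<subseteq> \<Lambda> \<longrightarrow> finite (u \<mu>) \<and> card (u \<mu>) = card \<mu>) \<and>
    (\<forall>x \<mu> \<nu>. finite \<nu> \<and> \<mu> \<subseteq> \<nu> \<and> \<nu> \<subseteq> \<Lambda> \<longrightarrow>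
      (\<Sum>y\<in>u \<mu>. ip x y * ip y x) \<le>\<^sub>A (\<Sum>y\<in>u \<nu>. ip x y * ip y x)) \<and>
    (\<forall>x. ((\<lambda>\<mu>. \<Sum>y\<in>u \<mu>. act (ip x y) y) \<longlongrightarrow> x) (finite_subsets_at_top \<Lambda>))"

end

theory Submission
  imports Defs
begin

text \<open>
  Take \<open>\<Lambda> = X\<close>. For a finite set \<open>\<mu>\<close> of \<open>n\<close> vectors put \<open>S = n \<Sum>\<^bsub>x\<in>\<mu>\<^esub> \<theta>\<^sub>x\<close>, where
  \<open>\<theta>\<^sub>x y = x (x|y)\<close>, and \<open>B = (1 + S)\<^sup>-\<^sup>1\<close>; let \<open>u\<^sub>\<mu>\<close> consist of the vectors \<open>\<surd>n \<surd>B x\<close> for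
  \<open>x \<in> \<mu>\<close>. As \<open>\<surd>B\<close> is injective, \<open>\<bar>u\<^sub>\<mu>\<bar> = n\<close>, and \<open>\<Sum>\<^bsub>y\<in>u\<^esub> \<theta>\<^sub>y = \<surd>B S \<surd>B = 1 - B\<close>
  increases with \<open>\<mu>\<close>, since inversion is antitone. If \<open>x \<in> \<mu>\<close> then \<open>n B \<theta>\<^sub>x B \<le> B S B \<le> 1\<close>, so
  \<open>\<parallel>B x\<parallel>\<^sup>2 = \<parallel>\<theta>\<^bsub>B x\<^esub>\<parallel> \<le> 1/n\<close>, which gives convergence.

  The order theory of a C*-algebra that this needs is obtained without spectral theory: square roots
  of \<open>1 - x\<close> come from an iteration, \<open>\<parallel>h\<parallel> \<le> 1\<close> for commuting self-adjoint \<open>h\<close>, \<open>k\<close> with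
  \<open>h\<^sup>2 + k\<^sup>2 = 1\<close> because \<open>h + \<i> k\<close> is unitary, and Kaplansky's theorem that every \<open>c\<^sup>* c\<close> is the
  square of a self-adjoint element from a norm estimate. It is applied first to the multipliers
  of \<open>A\<close>, which yields the Cauchy-Schwarz inequality on \<open>X\<close>, and then to the adjointable
  operators on \<open>X\<close>.
\<close>

section \<open>Positive elements of a unital C*-algebra\<close>

text \<open>The C*-identity is left to \<open>cstar_carrier\<close>, where it is imposed only on a
  subset; \<open>norm_one_le\<close> is an inequality so that the trivial algebra is
  included.\<close>

class star_banach_algebra = real_normed_algebra + banach + monoid_mult +
  fixes adj :: "'a \<Rightarrow> 'a"
  assumes adj_add: "adj (a + b) = adj a + adj b"
    and adj_scaleR: "adj (r *\<^sub>R a) = r *\<^sub>R adj a"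
    and adj_mult: "adj (a * b) = adj b * adj a"
    and adj_adj [simp]: "adj (adj a) = a"
    and norm_adj: "norm (adj a) = norm a"
    and norm_one_le: "norm 1 \<le> 1"

lemma adj_minus: "adj (- a) = - adj (a::'a::star_banach_algebra)"
  using adj_scaleR[of "-1" a] by simp

lemma adj_diff: "adj (a - b) = adj a - adj (b::'a::star_banach_algebra)"
  using adj_add[of a "- b"] by (simp add: adj_minus)

lemma adj_zero [simp]: "adj 0 = (0::'a::star_banach_algebra)"
  using adj_scaleR[of 0 "0::'a"] by simp

lemma adj_one [simp]: "adj 1 = (1::'a::star_banach_algebra)"
  by (metis adj_adj adj_mult mult_1_right)

lemma bounded_linear_adj: "bounded_linear (adj::'a::star_banach_algebra \<Rightarrow> 'a)"
  by (rule bounded_linear_intro[where K = 1]) (simp_all add: adj_add adj_scaleR norm_adj)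

section \<open>Square roots of \<open>1 - x\<close> by iteration\<close>

primrec sqrt_iter :: "'a::real_normed_algebra \<Rightarrow> nat \<Rightarrow> 'a" where
  "sqrt_iter x 0 = 0"
| "sqrt_iter x (Suc n) = (1/2) *\<^sub>R (x + sqrt_iter x n * sqrt_iter x n)"

lemma sqrt_iter_commute:
  fixes x :: "'a::real_normed_algebra"
  assumes "z * x = x * z"
  shows "z * sqrt_iter x n = sqrt_iter x n * z"
proof (induction n)
  case (Suc n)
  have "z * (sqrt_iter x n * sqrt_iter x n) = sqrt_iter x n * sqrt_iter x n * z"
    by (metis Suc mult.assoc)
  then show ?case using assms by (simp add: distrib_left distrib_right)
qed simp

lemma sqrt_iter_real: "0 \<le> sqrt_iter (1::real) n \<and> sqrt_iter (1::real) n \<le> 1"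
proof (induction n)
  case (Suc n)
  then have "sqrt_iter (1::real) n * sqrt_iter 1 n \<le> 1 * 1" by (intro mult_mono) auto
  with Suc show ?case by simp
qed simp

lemma sqrt_iter_real_Suc: "sqrt_iter (1::real) n \<le> sqrt_iter 1 (Suc n)"
proof -
  have "0 \<le> (1 - sqrt_iter (1::real) n)\<^sup>2" by simp
  then show ?thesis by (simp add: power2_eq_square algebra_simps)
qed

lemma norm_sqrt_iter_le:
  fixes x :: "'a::real_normed_algebra"
  assumes "norm x \<le> 1"
  shows "norm (sqrt_iter x n) \<le> sqrt_iter 1 n"
proof (induction n)
  case (Suc n)
  have "norm (sqrt_iter x n * sqrt_iter x n) \<le> sqrt_iter 1 n * sqrt_iter 1 n"
    by (rule order_trans[OF norm_mult_ineq]) (intro mult_mono Suc; simp add: sqrt_iter_real)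
  then have "norm (x + sqrt_iter x n * sqrt_iter x n) \<le> 1 + sqrt_iter 1 n * sqrt_iter 1 n"
    using assms by (intro order_trans[OF norm_triangle_ineq]) auto
  then show ?case by simp
qed simp

text \<open>The iterates commute, so the difference of two squares factors, and each factor is
  dominated by its scalar counterpart.\<close>

lemma norm_sqrt_iter_Suc_diff:
  fixes x :: "'a::real_normed_algebra"
  assumes "norm x \<le> 1"
  shows "norm (sqrt_iter x (Suc n) - sqrt_iter x n) \<le> sqrt_iter 1 (Suc n) - sqrt_iter 1 n"
proof (induction n)
  case 0
  then show ?case using assms by simp
next
  case (Suc n)
  define y where "y = sqrt_iter x n"
  define y' where "y' = sqrt_iter x (Suc n)"
  define s where "s = sqrt_iter (1::real) n"
  define s' where "s' = sqrt_iter (1::real) (Suc n)"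
  \<comment> \<open>\<open>sqrt_iter_commute\<close> is used twice: \<open>x\<close> commutes with
    \<open>y\<close>, hence \<open>y\<close> commutes with every iterate.\<close>
  have comm: "y * y' = y' * y"
    unfolding y_def y'_def by (metis sqrt_iter_commute)
  have *: "y' * y' - y * y = (y' - y) * (y' + y)"
    by (simp add: algebra_simps comm)
  have n: "norm y \<le> s" "norm y' \<le> s'"
    unfolding y_def y'_def s_def s'_def by (rule norm_sqrt_iter_le[OF assms])+
  have IH: "norm (y' - y) \<le> s' - s"
    using Suc unfolding y_def y'_def s_def s'_def .
  have "norm (y' * y' - y * y) \<le> norm (y' - y) * norm (y' + y)"
    unfolding * by (rule norm_mult_ineq)
  also have "\<dots> \<le> (s' - s) * (s' + s)"
  proof (intro mult_mono IH)
    show "norm (y' + y) \<le> s' + s"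
      using n norm_triangle_ineq[of y' y] by linarith
    show "0 \<le> s' - s" using IH norm_ge_zero order_trans by blast
  qed simp
  also have "\<dots> = s' * s' - s * s" by (simp add: algebra_simps)
  finally have 1: "norm (y' * y' - y * y) \<le> s' * s' - s * s" .
  have "sqrt_iter x (Suc (Suc n)) - sqrt_iter x (Suc n) = (1/2) *\<^sub>R (y' * y' - y * y)"
  proof -
    have "sqrt_iter x (Suc (Suc n)) = (1/2) *\<^sub>R (x + y' * y')"
      by (simp only: sqrt_iter.simps(2)[of x "Suc n"] y'_def)
    moreover have "sqrt_iter x (Suc n) = (1/2) *\<^sub>R (x + y * y)"
      by (simp add: y_def)
    ultimately show ?thesis by (simp only: scaleR_diff_right[symmetric]) simp
  qed
  moreover have "sqrt_iter (1::real) (Suc (Suc n)) - sqrt_iter 1 (Suc n) = (1/2) * (s' * s' - s * s)"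
  proof -
    have "sqrt_iter (1::real) (Suc (Suc n)) = (1/2) * (1 + s' * s')"
      by (simp only: sqrt_iter.simps(2)[of 1 "Suc n"] s'_def) simp
    moreover have "sqrt_iter (1::real) (Suc n) = (1/2) * (1 + s * s)"
      by (simp add: s_def)
    ultimately show ?thesis by (simp only: right_diff_distrib[symmetric]) simp
  qed
  ultimately show ?case using 1 by simp
qed

text \<open>The increments of the iteration are dominated by those of the scalar iteration at \<open>x = 1\<close>,
  which converges; this covers the boundary case \<open>\<parallel>x\<parallel> = 1\<close>, where the map
  \<open>y \<mapsto> (x + y\<^sup>2) / 2\<close> is not a contraction.\<close>

lemma sqrt_iter_convergent:
  fixes x :: "'a::{real_normed_algebra, banach}"
  assumes "norm x \<le> 1"
  shows "convergent (sqrt_iter x)"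
proof -
  let ?s = "sqrt_iter (1::real)"
  have s: "convergent ?s"
  proof (rule Bseq_mono_convergent)
    show "Bseq ?s" by (rule BseqI'[of _ 1]) (use sqrt_iter_real in simp)
    show "\<forall>m n. m \<le> n \<longrightarrow> ?s m \<le> ?s n"
      using lift_Suc_mono_le[of ?s] sqrt_iter_real_Suc by blast
  qed
  have diff: "norm (sqrt_iter x (n + k) - sqrt_iter x n) \<le> ?s (n + k) - ?s n" for n k
  proof (induction k)
    case (Suc k)
    have "norm (sqrt_iter x (n + Suc k) - sqrt_iter x n)
        \<le> norm (sqrt_iter x (Suc (n + k)) - sqrt_iter x (n + k))
          + norm (sqrt_iter x (n + k) - sqrt_iter x n)"
      using norm_triangle_ineq[of "sqrt_iter x (Suc (n + k)) - sqrt_iter x (n + k)"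
          "sqrt_iter x (n + k) - sqrt_iter x n"] by (simp del: sqrt_iter.simps)
    then show ?case
      using Suc norm_sqrt_iter_Suc_diff[OF assms, of "n + k"] by (simp del: sqrt_iter.simps)
  qed simp
  have "Cauchy (sqrt_iter x)"
  proof (rule metric_CauchyI)
    fix e :: real assume "e > 0"
    then obtain M where M: "\<And>m n. m \<ge> M \<Longrightarrow> n \<ge> M \<Longrightarrow> dist (?s m) (?s n) < e"
      using metric_CauchyD[OF convergent_Cauchy[OF s]] by blast
    have "dist (sqrt_iter x m) (sqrt_iter x n) < e" if "m \<ge> n" "n \<ge> M" for m n
      using diff[of n "m - n"] M[of m n] that by (simp add: dist_norm)
    then have "dist (sqrt_iter x m) (sqrt_iter x n) < e" if "m \<ge> M" "n \<ge> M" for m n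
      using that by (metis dist_commute linorder_linear)
    then show "\<exists>M. \<forall>m\<ge>M. \<forall>n\<ge>M. dist (sqrt_iter x m) (sqrt_iter x n) < e" by blast
  qed
  then show ?thesis by (simp add: Cauchy_convergent_iff)
qed

text \<open>\<open>J\<close> is a skew-adjoint square root of -1 commuting with \<open>C\<close>. It
  stands in for complex scalars, so that \<open>h + J * k\<close> can be formed in what is only a
  real algebra.\<close>

locale cstar_carrier =
  fixes C :: "'b::star_banach_algebra set" and J :: 'b
  assumes closed_C: "closed C"
    and one_C [simp]: "1 \<in> C"
    and J_C [simp]: "J \<in> C"
    and add_C: "a \<in> C \<Longrightarrow> b \<in> C \<Longrightarrow> a + b \<in> C"
    and scaleR_C: "a \<in> C \<Longrightarrow> r *\<^sub>R a \<in> C"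
    and mult_C: "a \<in> C \<Longrightarrow> b \<in> C \<Longrightarrow> a * b \<in> C"
    and adj_C: "a \<in> C \<Longrightarrow> adj a \<in> C"
    and norm_adj_mult: "a \<in> C \<Longrightarrow> norm (adj a * a) = (norm a)\<^sup>2"
    and J_J: "J * J = - 1"
    and adj_J: "adj J = - J"
    and J_commute: "a \<in> C \<Longrightarrow> J * a = a * J"
begin

lemma uminus_C: "a \<in> C \<Longrightarrow> - a \<in> C"
  using scaleR_C[of a "-1"] by simp

lemma diff_C: "a \<in> C \<Longrightarrow> b \<in> C \<Longrightarrow> a - b \<in> C"
  using add_C[of a "- b"] uminus_C by simp

lemma zero_C [simp]: "0 \<in> C"
  using scaleR_C[OF one_C, of 0] by simp

lemmas C_intros = add_C scaleR_C mult_C adj_C uminus_C diff_C zero_C one_C J_C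

definition SA :: "'b set" where "SA = {a \<in> C. adj a = a}"

lemma SA_C: "a \<in> SA \<Longrightarrow> a \<in> C" and SA_adj: "a \<in> SA \<Longrightarrow> adj a = a"
  by (auto simp: SA_def)

lemma SA_add: "a \<in> SA \<Longrightarrow> b \<in> SA \<Longrightarrow> a + b \<in> SA"
  and SA_diff: "a \<in> SA \<Longrightarrow> b \<in> SA \<Longrightarrow> a - b \<in> SA"
  and SA_scaleR: "a \<in> SA \<Longrightarrow> r *\<^sub>R a \<in> SA"
  and SA_zero: "0 \<in> SA"
  and SA_one: "1 \<in> SA"
  and SA_adj_mult: "b \<in> C \<Longrightarrow> adj b * b \<in> SA"
  and SA_square: "a \<in> SA \<Longrightarrow> a * a \<in> SA"
  and SA_mult: "a \<in> SA \<Longrightarrow> b \<in> SA \<Longrightarrow> a * b = b * a \<Longrightarrow> a * b \<in> SA"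
  by (auto simp: SA_def adj_add adj_diff adj_minus adj_scaleR adj_mult mult.assoc C_intros)

lemma norm_SA_square: "a \<in> SA \<Longrightarrow> norm (a * a) = (norm a)\<^sup>2"
  using norm_adj_mult[of a] by (simp add: SA_def)

text \<open>The limit \<open>y\<close> of the iteration satisfies 2 y = x + y^2, which is (1 - y)^2
  = 1 - x. The last conclusion puts \<open>y\<close> in the bicommutant of \<open>x\<close>; later
  arguments with two roots use it to make them commute.\<close>

lemma sqrt_one_minus:
  assumes x: "x \<in> SA" "norm x \<le> 1"
  obtains y where "y \<in> SA" "norm y \<le> 1" "(1 - y) * (1 - y) = 1 - x"
    "\<forall>z. z * x = x * z \<longrightarrow> z * y = y * z"
proof -
  obtain y where lim: "sqrt_iter x \<longlonglongrightarrow> y"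
    using sqrt_iter_convergent[OF x(2)] by (auto simp: convergent_def)
  have it: "sqrt_iter x n \<in> SA" for n
    by (induction n) (auto intro: SA_zero SA_scaleR SA_add SA_square x(1))
  have "y \<in> C"
    using closed_sequentially[OF closed_C _ lim] it SA_C by blast
  moreover have "(\<lambda>n. adj (sqrt_iter x n)) \<longlonglongrightarrow> adj y"
    by (rule bounded_linear.tendsto[OF bounded_linear_adj lim])
  then have "sqrt_iter x \<longlonglongrightarrow> adj y" by (simp add: SA_adj[OF it])
  then have "adj y = y" using lim by (rule LIMSEQ_unique)
  ultimately have 1: "y \<in> SA" by (simp add: SA_def)
  have 2: "norm y \<le> 1"
  proof (rule Lim_bounded[OF tendsto_norm[OF lim]])
    show "\<forall>n\<ge>0. norm (sqrt_iter x n) \<le> 1"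
      using norm_sqrt_iter_le[OF x(2)] sqrt_iter_real order_trans by blast
  qed
  have "(\<lambda>n. (1/2) *\<^sub>R (x + sqrt_iter x n * sqrt_iter x n)) \<longlonglongrightarrow> (1/2) *\<^sub>R (x + y * y)"
    by (intro tendsto_intros lim)
  then have "(\<lambda>n. sqrt_iter x (Suc n)) \<longlonglongrightarrow> (1/2) *\<^sub>R (x + y * y)" by simp
  with LIMSEQ_Suc[OF lim] have "y = (1/2) *\<^sub>R (x + y * y)" by (rule LIMSEQ_unique)
  then have "2 *\<^sub>R y = 2 *\<^sub>R ((1/2) *\<^sub>R (x + y * y))" by (rule arg_cong)
  then have "y + y = x + y * y" by (simp add: scaleR_2[symmetric])
  then have 3: "(1 - y) * (1 - y) = 1 - x"
    by (simp add: algebra_simps)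
  have 4: "z * y = y * z" if "z * x = x * z" for z
  proof -
    have "(\<lambda>n. z * sqrt_iter x n) \<longlonglongrightarrow> z * y" "(\<lambda>n. sqrt_iter x n * z) \<longlonglongrightarrow> y * z"
      by (intro tendsto_intros lim)+
    then show ?thesis
      unfolding sqrt_iter_commute[OF that] by (rule LIMSEQ_unique)
  qed
  show thesis using that 1 2 3 4 by blast
qed

text \<open>\<open>h + J k\<close> is unitary.\<close>

lemma norm_le_one_of_squares:
  assumes h: "h \<in> SA" and k: "k \<in> SA" and hk: "h * k = k * h" and s: "h * h + k * k = 1"
  shows "norm h \<le> 1"
proof -
  define u where "u = h + J * k"
  have uC: "u \<in> C" unfolding u_def by (intro C_intros SA_C h k)
  have au: "adj u = h - J * k"
    using h k J_commute[of k] by (simp add: u_def adj_add adj_mult adj_J SA_adj SA_C)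
  have Jh: "J * h = h * J" "J * k = k * J" using h k J_commute SA_C by auto
  have "adj u * u = h * h + (h * J * k - J * k * h) - J * k * J * k"
    unfolding au unfolding u_def by (simp add: algebra_simps mult.assoc)
  also have "J * k * h = h * J * k" by (metis Jh(1) hk mult.assoc)
  also have "J * k * J * k = - (k * k)"
    by (metis Jh(2) J_J mult.assoc mult_minus_left mult_1)
  finally have "adj u * u = 1" using s by simp
  then have "(norm u)\<^sup>2 \<le> 1" using norm_adj_mult[OF uC] norm_one_le by metis
  then have nu: "norm u \<le> 1" by (simp add: power2_le_iff_abs_le[of 1, simplified])
  have "2 *\<^sub>R h = u + adj u" unfolding au by (simp add: u_def scaleR_2)
  then have "2 * norm h \<le> norm u + norm (adj u)"
    by (metis norm_scaleR abs_numeral norm_triangle_ineq)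
  then show ?thesis using nu by (simp add: norm_adj)
qed

text \<open>If \<open>1 - h * h\<close> is the square of \<open>1 - y\<close>, then
  \<open>1 - y\<close> and \<open>h\<close> commute and their squares sum to 1, so
  \<open>norm_le_one_of_squares\<close> bounds \<open>1 - y\<close>.\<close>

lemma norm_one_minus_square:
  assumes h: "h \<in> SA" "norm h \<le> 1"
  shows "norm (1 - h * h) \<le> 1"
proof -
  have "norm (h * h) \<le> 1"
    using h by (simp add: norm_SA_square power_le_one)
  then obtain y where y: "y \<in> SA" "(1 - y) * (1 - y) = 1 - h * h"
      and yc: "\<forall>z. z * (h * h) = h * h * z \<longrightarrow> z * y = y * z"
    by (rule sqrt_one_minus[OF SA_square[OF h(1)]])
  have "h * y = y * h" by (rule yc[rule_format]) (simp add: mult.assoc)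
  then have "norm (1 - y) \<le> 1"
    by (intro norm_le_one_of_squares[of _ h])
      (use h y in \<open>auto intro: SA_one SA_diff simp: algebra_simps\<close>)
  then have "norm ((1 - y) * (1 - y)) \<le> 1 * 1"
    by (intro order_trans[OF norm_mult_ineq] mult_mono) auto
  then show ?thesis by (simp add: y(2))
qed

section \<open>The cone of positive elements and its description by norms\<close>

definition pos :: "'b \<Rightarrow> bool" where "pos a \<longleftrightarrow> (\<exists>h\<in>SA. a = h * h)"

lemma pos_square: "h \<in> SA \<Longrightarrow> pos (h * h)"
  unfolding pos_def by blast

lemma pos_SA: "pos a \<Longrightarrow> a \<in> SA"
  unfolding pos_def using SA_square by blast

lemma pos_scaleR:
  assumes "pos a" "0 \<le> r"
  shows "pos (r *\<^sub>R a)"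
proof -
  obtain h where h: "h \<in> SA" "a = h * h" using assms(1) by (auto simp: pos_def)
  then have "r *\<^sub>R a = (sqrt r *\<^sub>R h) * (sqrt r *\<^sub>R h)" using assms(2) by simp
  then show ?thesis by (simp only: pos_square[OF SA_scaleR[OF h(1)]])
qed

lemma pos_scaleR_iff: "0 < r \<Longrightarrow> pos (r *\<^sub>R a) \<longleftrightarrow> pos a"
  using pos_scaleR[of "r *\<^sub>R a" "inverse r"] pos_scaleR[of a r] by auto

lemma pos_zero: "pos 0" and pos_one: "pos 1"
  using pos_square[OF SA_zero] pos_square[OF SA_one] by simp_all

text \<open>This is \<open>sqrt_one_minus\<close> for \<open>1 - a\<close>, with root
  \<open>k = 1 - y\<close>. The bound on \<open>1 - k\<close> makes \<open>k\<close> positive in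
  turn, by \<open>pos_unitI\<close>.\<close>

lemma pos_sqrt_unit:
  assumes a: "a \<in> SA" "norm (1 - a) \<le> 1"
  obtains k where "k \<in> SA" "norm (1 - k) \<le> 1" "a = k * k"
    "\<forall>z. z * a = a * z \<longrightarrow> z * k = k * z"
proof -
  obtain y where y: "y \<in> SA" "norm y \<le> 1" "(1 - y) * (1 - y) = 1 - (1 - a)"
      and yc: "\<forall>z. z * (1 - a) = (1 - a) * z \<longrightarrow> z * y = y * z"
    by (rule sqrt_one_minus[OF SA_diff[OF SA_one a(1)] a(2)])
  have "\<forall>z. z * a = a * z \<longrightarrow> z * (1 - y) = (1 - y) * z"
    using yc by (simp add: left_diff_distrib right_diff_distrib)
  moreover have "1 - y \<in> SA" "norm (1 - (1 - y)) \<le> 1" "a = (1 - y) * (1 - y)"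
    using y by (simp_all add: SA_diff SA_one)
  ultimately show thesis using that by blast
qed

lemma pos_unitI: "a \<in> SA \<Longrightarrow> norm (1 - a) \<le> 1 \<Longrightarrow> pos a"
  by (metis pos_sqrt_unit pos_def)

lemma pos_unitD:
  assumes "pos a" "norm a \<le> 1"
  shows "norm (1 - a) \<le> 1"
proof -
  obtain h where h: "h \<in> SA" "a = h * h" using assms(1) by (auto simp: pos_def)
  then have "(norm h)\<^sup>2 \<le> 1" using assms(2) by (simp add: norm_SA_square)
  then have "norm h \<le> 1" by (simp add: power2_le_iff_abs_le[of 1, simplified])
  then show ?thesis using norm_one_minus_square h by simp
qed

lemma pos_norm_diff:
  assumes "pos a" "norm a \<le> M"
  shows "norm (M *\<^sub>R 1 - a) \<le> M"
proof (cases "M = 0")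
  case False
  then have M: "M > 0" using assms(2) norm_ge_zero[of a] by linarith
  have "norm (1 - inverse M *\<^sub>R a) \<le> 1"
    by (rule pos_unitD) (use assms M in \<open>auto intro!: pos_scaleR simp: field_simps\<close>)
  then have "norm (M *\<^sub>R (1 - inverse M *\<^sub>R a)) \<le> M" using M by simp
  then show ?thesis using M by (simp add: scaleR_diff_right)
qed (use assms in auto)

lemma pos_sqrt:
  assumes "pos a"
  obtains k where "pos k" "a = k * k" "\<forall>z. z * a = a * z \<longrightarrow> z * k = k * z"
proof (cases "a = 0")
  case True
  then show ?thesis by (intro that[of 0]) (simp_all add: pos_zero)
next
  case False
  define M where "M = norm a"
  have M: "M > 0" using False by (simp add: M_def)
  have p: "pos (inverse M *\<^sub>R a)" using assms M by (simp add: pos_scaleR)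
  moreover have "norm (inverse M *\<^sub>R a) \<le> 1" using M by (simp add: M_def)
  ultimately obtain k where k: "k \<in> SA" "norm (1 - k) \<le> 1" "inverse M *\<^sub>R a = k * k"
      and kc: "\<forall>z. z * (inverse M *\<^sub>R a) = (inverse M *\<^sub>R a) * z \<longrightarrow> z * k = k * z"
    using pos_sqrt_unit[OF pos_SA[OF p] pos_unitD[OF p]] by metis
  have "a = M *\<^sub>R (k * k)" using M k(3)[symmetric] by simp
  then have "a = (sqrt M *\<^sub>R k) * (sqrt M *\<^sub>R k)" using M by simp
  moreover have "pos (sqrt M *\<^sub>R k)" using M k by (intro pos_scaleR pos_unitI) auto
  moreover have "\<forall>z. z * a = a * z \<longrightarrow> z * (sqrt M *\<^sub>R k) = sqrt M *\<^sub>R k * z"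
    using kc M by simp
  ultimately show thesis using that by blast
qed

lemma pos_of_norm_diff:
  assumes a: "a \<in> SA" and n: "norm (M *\<^sub>R 1 - a) \<le> M" and M: "M > 0"
  shows "pos a"
proof -
  have "1 - inverse M *\<^sub>R a = inverse M *\<^sub>R (M *\<^sub>R 1 - a)"
    using M by (simp add: scaleR_diff_right)
  then have "norm (1 - inverse M *\<^sub>R a) = inverse M * norm (M *\<^sub>R 1 - a)"
    using M by simp
  also have "\<dots> \<le> 1" using n M by (simp add: field_simps)
  finally have "pos (inverse M *\<^sub>R a)" by (intro pos_unitI SA_scaleR a)
  then show ?thesis using M pos_scaleR_iff[of "inverse M"] by simp
qed

text \<open>Positivity of \<open>a\<close> is traded for the bound M on the norm of M - a, with M
  large; such bounds add up by the triangle inequality.\<close>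

lemma pos_add:
  assumes "pos a" "pos b"
  shows "pos (a + b)"
proof -
  \<comment> \<open>The summand 1 keeps \<open>M\<close> positive even for
    \<open>a = b = 0\<close>.\<close>
  define M where "M = norm a + norm b + 1"
  have M: "M > 0" by (simp add: M_def add_nonneg_pos)
  have "norm (M *\<^sub>R 1 - a) \<le> M" "norm (M *\<^sub>R 1 - b) \<le> M"
    using assms by (auto intro!: pos_norm_diff simp: M_def)
  then have "norm ((M *\<^sub>R 1 - a) + (M *\<^sub>R 1 - b)) \<le> M + M"
    using norm_triangle_ineq[of "M *\<^sub>R 1 - a" "M *\<^sub>R 1 - b"] by linarith
  moreover have "(M *\<^sub>R 1 - a) + (M *\<^sub>R 1 - b) = (M + M) *\<^sub>R 1 - (a + b)"
    by (simp only: scaleR_add_left add_diff_add)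
  ultimately show ?thesis
    using M by (intro pos_of_norm_diff[OF SA_add[OF assms[THEN pos_SA]], of "M + M"]) simp_all
qed

lemma pos_sum: "(\<And>i. i \<in> I \<Longrightarrow> pos (f i)) \<Longrightarrow> pos (\<Sum>i\<in>I. f i)"
  by (induction I rule: infinite_finite_induct) (auto intro: pos_zero pos_add)

text \<open>If \<open>a = k * k\<close> and \<open>- a = m * m\<close> with commuting
  \<open>k\<close>, \<open>m\<close>, then \<open>u = k + J * m\<close> has
  \<open>adj u * u = 0\<close>. Hence \<open>u = 0\<close>, and its self-adjoint part
  \<open>k\<close> vanishes.\<close>

lemma pos_neg_zero:
  assumes "pos a" "pos (- a)"
  shows "a = 0"
proof -
  obtain k where k: "pos k" "a = k * k" and kc: "\<forall>z. z * a = a * z \<longrightarrow> z * k = k * z"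
    by (rule pos_sqrt[OF assms(1)])
  obtain m where m: "pos m" "- a = m * m" and mc: "\<forall>z. z * - a = - a * z \<longrightarrow> z * m = m * z"
    by (rule pos_sqrt[OF assms(2)])
  have km: "k * m = m * k" by (rule mc[rule_format]) (simp add: k(2) mult.assoc)
  have kS: "k \<in> SA" "m \<in> SA" using k m pos_SA by auto
  define u where "u = k + J * m"
  have uC: "u \<in> C" unfolding u_def by (intro C_intros SA_C kS)
  have au: "adj u = k - J * m"
    using kS J_commute[of m] by (simp add: u_def adj_add adj_mult adj_J SA_adj SA_C)
  have Jh: "J * k = k * J" "J * m = m * J" using kS J_commute SA_C by auto
  have "adj u * u = k * k + (k * J * m - J * m * k) - J * m * J * m"
    unfolding au unfolding u_def by (simp add: algebra_simps mult.assoc)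
  also have "J * m * k = k * J * m" by (metis Jh(1) km mult.assoc)
  also have "J * m * J * m = - (m * m)"
    by (metis Jh(2) J_J mult.assoc mult_minus_left mult_1)
  finally have "adj u * u = 0" by (simp flip: k(2) m(2))
  then have "u = 0" using norm_adj_mult[OF uC] by simp
  then have "u + adj u = 0" by simp
  then have "2 *\<^sub>R k = 0" unfolding au by (simp add: u_def scaleR_2)
  then show ?thesis using k(2) by simp
qed

lemma pos_norm_minus:
  assumes "pos a" "norm a \<le> M"
  shows "pos (M *\<^sub>R 1 - a)"
proof (cases "M = 0")
  case True then show ?thesis using assms pos_zero by simp
next
  case False
  then have M: "M > 0" using assms(2) norm_ge_zero[of a] by linarith
  then show ?thesis
    by (intro pos_of_norm_diff[OF SA_diff[OF SA_scaleR[OF SA_one] pos_SA[OF assms(1)]], of M])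
      (use assms(2) in simp_all)
qed

text \<open>After rescaling to M = 1, the commuting roots of \<open>a\<close> and
  \<open>1 - a\<close> have squares summing to 1, and \<open>norm_le_one_of_squares\<close>
  applies.\<close>

lemma norm_le_of_pos:
  assumes "pos a" "pos (M *\<^sub>R 1 - a)" "0 \<le> M"
  shows "norm a \<le> M"
proof (cases "M = 0")
  case True
  then show ?thesis using assms pos_neg_zero[of a] by simp
next
  case False
  then have M: "M > 0" using assms(3) by simp
  obtain h where h: "pos h" "inverse M *\<^sub>R a = h * h"
    using pos_sqrt[OF pos_scaleR[OF assms(1), of "inverse M"]] M
    by (metis less_imp_le positive_imp_inverse_positive)
  have "inverse M *\<^sub>R (M *\<^sub>R 1 - a) = 1 - h * h"
    using M by (simp add: scaleR_diff_right h(2)[symmetric])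
  then have "pos (1 - h * h)"
    using pos_scaleR[OF assms(2), of "inverse M"] M by simp
  then obtain k where k: "pos k" "1 - h * h = k * k"
      and kc: "\<forall>z. z * (1 - h * h) = (1 - h * h) * z \<longrightarrow> z * k = k * z"
    by (rule pos_sqrt)
  have hk: "h * k = k * h" by (rule kc[rule_format]) (simp add: algebra_simps)
  have "norm h \<le> 1"
    by (rule norm_le_one_of_squares[of h k]) (use h k hk pos_SA in \<open>auto simp: k(2)[symmetric]\<close>)
  then have "norm (h * h) \<le> 1"
    by (simp add: norm_SA_square pos_SA[OF h(1)] power_le_one)
  then have "norm (inverse M *\<^sub>R a) \<le> 1" by (simp only: h(2))
  then show ?thesis using M by (simp add: field_simps)
qed

lemma pos_norm_mono:
  assumes "pos a" "pos (b - a)"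
  shows "norm a \<le> norm b"
proof (rule norm_le_of_pos[OF assms(1)])
  have "pos b" using pos_add[OF assms] by simp
  then have "pos (norm b *\<^sub>R 1 - b)" by (rule pos_norm_minus) simp
  from pos_add[OF this assms(2)] show "pos (norm b *\<^sub>R 1 - a)" by simp
qed simp

text \<open>Two uses of the bicommutant property make the roots of \<open>a\<close> and
  \<open>b\<close> commute, so \<open>a * b\<close> is the square of their product.\<close>

lemma pos_mult_commute:
  assumes "pos a" "pos b" "a * b = b * a"
  shows "pos (a * b)"
proof -
  obtain k where k: "pos k" "a = k * k" and kc: "\<forall>z. z * a = a * z \<longrightarrow> z * k = k * z"
    by (rule pos_sqrt[OF assms(1)])
  obtain m where m: "pos m" "b = m * m" and mc: "\<forall>z. z * b = b * z \<longrightarrow> z * m = m * z"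
    by (rule pos_sqrt[OF assms(2)])
  have "b * k = k * b" using kc[rule_format, of b] assms(3) by simp
  then have km: "k * m = m * k" using mc[rule_format, of k] by simp
  then have "a * b = (k * m) * (k * m)" by (metis k(2) m(2) mult.assoc)
  then show ?thesis using pos_square[OF SA_mult[OF _ _ km]] k m pos_SA by simp
qed

text \<open>Here \<open>n = (\<bar>a\<bar> - a) / 2\<close> is the negative part of \<open>a\<close>; its positivity is not available yet,
  but \<open>n\<^sup>2 = \<bar>a\<bar> n\<close> exhibits \<open>n\<^sup>3\<close> as the square of \<open>m = \<bar>a\<bar>\<^sup>1\<^sup>/\<^sup>2 n\<close>.\<close>

lemma negative_part:
  assumes a: "a \<in> SA"
  obtains n m where "n \<in> SA" "m \<in> SA" "n * a * n = - (m * m)" "m = 0 \<longrightarrow> pos a"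
proof -
  obtain h where h: "pos h" "a * a = h * h" and hc: "\<forall>z. z * (a * a) = a * a * z \<longrightarrow> z * h = h * z"
    by (rule pos_sqrt[OF pos_square[OF a]])
  have ah: "a * h = h * a" by (rule hc[rule_format]) (simp add: mult.assoc)
  define n where "n = (1/2) *\<^sub>R (h - a)"
  have n: "n \<in> SA" unfolding n_def by (intro SA_scaleR SA_diff a pos_SA h(1))
  have hn: "n * h = h * n" by (simp add: n_def algebra_simps ah)
  obtain r where r: "pos r" "h = r * r" and rc: "\<forall>z. z * h = h * z \<longrightarrow> z * r = r * z"
    by (rule pos_sqrt[OF h(1)])
  have rn: "n * r = r * n" by (rule rc[rule_format, OF hn])
  define m where "m = r * n"
  have m: "m \<in> SA" unfolding m_def by (rule SA_mult) (use r n rn pos_SA in auto)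
  \<comment> \<open>By \<open>a * a = h * h\<close>, the product \<open>n * a\<close> is half of
    \<open>h * a - h * h\<close>.\<close>
  have na: "n * a = - (h * n)"
    by (simp add: n_def algebra_simps ah h(2))
  have "n * a * n = - (m * m)"
    unfolding na m_def r(2) by (metis minus_mult_left mult.assoc rn)
  moreover have "pos a" if "m = 0"
  proof -
    have nn: "n * n = h * n"
    proof -
      have "n * n = (1/2) *\<^sub>R (n * h - n * a)" unfolding n_def by (simp add: algebra_simps)
      also have "\<dots> = (1/2) *\<^sub>R (h * n + h * n)" by (simp add: na hn)
      finally show ?thesis by (simp add: scaleR_2[symmetric])
    qed
    have "h * n = 0" using that unfolding r(2) m_def by (metis mult.assoc mult_zero_right)
    then have "n * n = 0" using nn by simp
    then have "n = 0" using norm_SA_square[OF n] by simp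
    then show ?thesis using h(1) by (simp add: n_def)
  qed
  ultimately show thesis using that n m by blast
qed

text \<open>\<open>h\<close> and \<open>k\<close> are, up to sign, twice the real and imaginary
  parts of \<open>d\<close>; in the sum of their squares the terms d^2 and its adjoint
  cancel.\<close>

lemma pos_adj_mult_add_mult_adj:
  assumes d: "d \<in> C"
  shows "pos (adj d * d + d * adj d)"
proof -
  define h where "h = d + adj d"
  define k where "k = J * (d - adj d)"
  have h: "h \<in> SA" unfolding SA_def h_def using d by (auto intro: C_intros simp: adj_add)
  have "adj k = k"
    unfolding k_def using J_commute[of "adj d - d"] d
    by (simp add: adj_mult adj_diff adj_J diff_C adj_C algebra_simps)
  then have k: "k \<in> SA" unfolding SA_def k_def using d by (auto intro: C_intros)
  have "k * k = J * ((d - adj d) * J) * (d - adj d)" by (simp add: k_def mult.assoc)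
  also have "(d - adj d) * J = J * (d - adj d)" using J_commute d by (simp add: C_intros)
  also have "J * (J * (d - adj d)) * (d - adj d) = - ((d - adj d) * (d - adj d))"
    by (metis J_J mult.assoc mult_minus_left mult_1)
  finally have "h * h + k * k = 2 *\<^sub>R (adj d * d + d * adj d)"
    by (simp add: h_def algebra_simps scaleR_2)
  moreover have "pos (h * h + k * k)" by (intro pos_add pos_square h k)
  ultimately show ?thesis using pos_scaleR_iff[of 2] by simp
qed

text \<open>With \<open>b = m\<^sup>2\<close>, \<open>q = d d\<^sup>*\<close> and \<open>M = \<parallel>b\<parallel>\<close>: the element \<open>b (M + b) = - d\<^sup>* (M - q) d\<close> has norm
  at most \<open>M\<^sup>2\<close>, but dominates \<open>2 b\<^sup>2\<close>.\<close>

lemma adj_mult_neg_square: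
  assumes d: "d \<in> C" and m: "m \<in> SA" and dm: "adj d * d = - (m * m)"
  shows "m = 0"
proof -
  define b where "b = m * m"
  define q where "q = d * adj d"
  define M where "M = norm b"
  have b: "pos b" "b \<in> SA" unfolding b_def using m by (auto intro: pos_square SA_square)
  have M0: "M \<ge> 0" by (simp add: M_def)
  have db: "adj d * d = - b" using dm by (simp add: b_def)
  \<comment> \<open>\<open>q\<close> is the sum of the positive elements
    \<open>adj d * d + d * adj d\<close> and \<open>b\<close>.\<close>
  have q: "pos q"
    using pos_add[OF pos_adj_mult_add_mult_adj[OF d] b(1)] by (simp add: q_def db)
  have nd: "(norm d)\<^sup>2 = M" using norm_adj_mult[OF d] by (simp add: db M_def)
  have nq: "norm q = M"
    using norm_adj_mult[OF adj_C[OF d]] nd by (simp add: q_def norm_adj)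
  have "b * (M *\<^sub>R 1 + b) = - (adj d * (M *\<^sub>R 1 - q) * d)"
    using db by (simp add: q_def algebra_simps) (simp add: mult.assoc[symmetric] db)
  then have "norm (b * (M *\<^sub>R 1 + b)) \<le> norm (adj d) * norm (M *\<^sub>R 1 - q) * norm d"
    by (smt (verit) mult_right_mono norm_ge_zero norm_minus_cancel norm_mult_ineq)
  also have "\<dots> \<le> norm d * M * norm d"
    using pos_norm_diff[OF q, of M] nq by (intro mult_mono) (auto simp: norm_adj M0)
  also have "\<dots> = M\<^sup>2" using nd by (simp add: power2_eq_square mult_ac)
  finally have 1: "norm (b * (M *\<^sub>R 1 + b)) \<le> M\<^sup>2" .
  \<comment> \<open>b (M + b) exceeds 2 b^2 by b (M - b), a product of commuting positive
    elements.\<close>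
  have "pos (b * (M *\<^sub>R 1 - b))"
    using b by (intro pos_mult_commute pos_norm_minus) (auto simp: M_def algebra_simps)
  then have "norm (2 *\<^sub>R (b * b)) \<le> norm (b * (M *\<^sub>R 1 + b))"
    by (intro pos_norm_mono pos_scaleR pos_square b(2)) (auto simp: algebra_simps scaleR_2)
  then have "2 * norm (b * b) \<le> norm (b * (M *\<^sub>R 1 + b))" by simp
  then have "2 * M\<^sup>2 \<le> M\<^sup>2" using 1 norm_SA_square[OF b(2)] by (simp only: M_def)
  then have "M\<^sup>2 \<le> 0" by linarith
  then have "M = 0" by simp
  then have "m * m = 0" by (simp add: M_def b_def)
  then show ?thesis using norm_SA_square[OF m] by simp
qed

text \<open>Kaplansky's theorem. With \<open>n\<close> the negative part of
  \<open>adj c * c\<close>, the element \<open>d = c * n\<close> has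
  \<open>adj d * d = - (m * m)\<close>, and \<open>adj_mult_neg_square\<close> gives
  \<open>m = 0\<close>.\<close>

lemma pos_adj_mult:
  assumes c: "c \<in> C"
  shows "pos (adj c * c)"
proof -
  obtain n m where nm: "n \<in> SA" "m \<in> SA" "n * (adj c * c) * n = - (m * m)"
      "m = 0 \<longrightarrow> pos (adj c * c)"
    by (rule negative_part[OF SA_adj_mult[OF c]])
  have "adj (c * n) * (c * n) = - (m * m)"
    using nm(3) by (simp add: adj_mult SA_adj[OF nm(1)] mult.assoc)
  then have "m = 0"
    using adj_mult_neg_square[of "c * n" m] c nm SA_C mult_C by blast
  then show ?thesis by (simp add: nm(4))
qed

lemma pos_conj:
  assumes "pos q" "c \<in> C"
  shows "pos (adj c * q * c)"
proof -
  obtain r where r: "r \<in> SA" "q = r * r" using assms(1) by (auto simp: pos_def)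
  have "adj c * q * c = adj (r * c) * (r * c)"
    by (simp add: r adj_mult SA_adj mult.assoc)
  then show ?thesis using pos_adj_mult[of "r * c"] r assms SA_C mult_C by simp
qed

lemma pos_conj_SA: "pos q \<Longrightarrow> c \<in> SA \<Longrightarrow> pos (c * q * c)"
  using pos_conj[of q c] by (simp add: SA_def)

text \<open>(1 + s) / (1 + N) is 1 - x with the norm of x below 1, hence invertible. The inverse is
  positive because it equals \<open>b * (1 + s) * b\<close>.\<close>

lemma inverse_one_plus:
  assumes s: "pos s"
  obtains b where "pos b" "b * (1 + s) = 1" "(1 + s) * b = 1"
proof -
  define N where "N = norm s"
  have N0: "N \<ge> 0" by (simp add: N_def)
  define x where "x = inverse (1 + N) *\<^sub>R (N *\<^sub>R 1 - s)"
  have x: "x \<in> SA" unfolding x_def by (intro SA_scaleR SA_diff SA_one pos_SA s)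
  have "norm x \<le> inverse (1 + N) * N"
    using pos_norm_diff[OF s, of N] N0 by (simp add: x_def N_def mult_left_mono)
  moreover have "inverse (1 + N) * N < 1" using N0 by (simp add: field_simps)
  ultimately have nx: "norm x < 1" by linarith
  \<comment> \<open>The inverse of \<open>1 - x\<close> is the fixed point of y -> 1 + x y;
    iterating inside the complete set \<open>C\<close> keeps it in the carrier.\<close>
  have "\<exists>!y. y \<in> C \<and> 1 + x * y = y"
  proof (rule Banach_fix[where c = "norm x"])
    show "complete C" using closed_C by (simp add: complete_eq_closed)
    show "C \<noteq> {}" using one_C by blast
    show "(\<lambda>y. 1 + x * y) ` C \<subseteq> C" using x SA_C by (auto intro: C_intros)
    show "dist (1 + x * y) (1 + x * z) \<le> norm x * dist y z" if "y \<in> C" "z \<in> C" for y z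
      using norm_mult_ineq[of x "y - z"] by (simp add: dist_norm right_diff_distrib)
  qed (use nx in auto)
  then obtain y where y: "y \<in> C" "1 + x * y = y" by blast
  have 1: "(1 - x) * y = 1" using y(2) by (simp add: algebra_simps)
  \<comment> \<open>The adjoint of a right inverse of the self-adjoint \<open>1 - x\<close> is a
    left inverse, so the two coincide.\<close>
  then have "adj y * (1 - x) = 1" using x
    by (metis adj_mult adj_one adj_diff SA_adj)
  moreover from this 1 have "adj y = y" by (metis mult.assoc mult_1 mult_1_right)
  ultimately have 2: "y * (1 - x) = 1" by simp
  define b where "b = inverse (1 + N) *\<^sub>R y"
  have xs: "1 - x = inverse (1 + N) *\<^sub>R (1 + s)"
  proof -
    have "inverse (1 + N) *\<^sub>R ((1 + N) *\<^sub>R (1::'b)) = 1" using N0 by simp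
    then have "1 - x = inverse (1 + N) *\<^sub>R ((1 + N) *\<^sub>R 1 - (N *\<^sub>R 1 - s))"
      by (simp only: x_def scaleR_diff_right)
    then show ?thesis by (simp add: algebra_simps)
  qed
  have b1: "b * (1 + s) = 1" "(1 + s) * b = 1"
    using 1 2 unfolding xs b_def by (simp_all del: scaleR_add_right)
  have bS: "b \<in> SA" using y(1) \<open>adj y = y\<close> by (auto simp: b_def SA_def adj_scaleR intro: scaleR_C)
  have "pos (b * (1 + s) * b)" by (intro pos_conj_SA pos_add pos_one s bS)
  then have "pos b" using b1 by simp
  then show thesis using that b1 by blast
qed

text \<open>With \<open>d = t - s\<close> one has \<open>b - c = c * (d + d * b * d) * c\<close>, a
  conjugate of a positive element.\<close>

lemma inverse_antimono:
  assumes s: "pos (t - s)"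
    and b: "pos b" "b * (1 + s) = 1" "(1 + s) * b = 1"
    and c: "pos c" "c * (1 + t) = 1" "(1 + t) * c = 1"
  shows "pos (b - c)"
proof -
  define d where "d = t - s"
  have t: "1 + t = (1 + s) + d" by (simp add: d_def)
  have "(1 + t) * b * (1 + t) = (1 + s) * b * (1 + s) + d * (b * (1 + s)) + ((1 + s) * b) * d + d * b * d"
    unfolding t by (simp only: distrib_left distrib_right mult.assoc add_ac)
  also have "\<dots> = (1 + t) + (d + d * b * d)" by (simp add: b t)
  finally have 1: "(1 + t) * b * (1 + t) - (1 + t) = d + d * b * d" by simp
  have "c * ((1 + t) * b * (1 + t) - (1 + t)) * c = (c * (1 + t)) * b * ((1 + t) * c) - (c * (1 + t)) * c"
    by (simp only: right_diff_distrib left_diff_distrib mult.assoc)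
  then have "b - c = c * (d + d * b * d) * c" unfolding 1 by (simp add: c)
  moreover have "pos (c * (d + d * b * d) * c)"
    using s b(1) c(1) by (intro pos_conj_SA pos_add) (auto simp: d_def intro: pos_SA)
  ultimately show ?thesis by simp
qed

end

section \<open>Pairs of operators\<close>

text \<open>An operator is stored together with a candidate for its adjoint. The involution is then total
  and swaps the components; the C*-identity holds only on the closed subalgebra of genuine adjoint
  pairs. \<^class>\<open>monoid_mult\<close> is used instead of \<^class>\<open>ring_1\<close> because \<open>0 = 1\<close> when the space is trivial.\<close>

typedef (overloaded) 'x oppair = "UNIV :: (('x::real_normed_vector \<Rightarrow>\<^sub>L 'x) \<times> ('x \<Rightarrow>\<^sub>L 'x)) set" ..

setup_lifting type_definition_oppair

lemma norm_blinfun_compose_swap_le: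
  fixes S S' T T' :: "'x::real_normed_vector \<Rightarrow>\<^sub>L 'x"
  shows "max (norm (S o\<^sub>L T)) (norm (T' o\<^sub>L S')) \<le> max (norm S) (norm S') * max (norm T) (norm T')"
proof (rule max.boundedI)
  show "norm (S o\<^sub>L T) \<le> max (norm S) (norm S') * max (norm T) (norm T')"
    by (rule order_trans[OF norm_blinfun_compose]) (intro mult_mono; simp add: le_max_iff_disj)
  show "norm (T' o\<^sub>L S') \<le> max (norm S) (norm S') * max (norm T) (norm T')"
    by (subst mult.commute, rule order_trans[OF norm_blinfun_compose])
      (intro mult_mono; simp add: le_max_iff_disj)
qed

instantiation oppair :: (real_normed_vector) real_normed_algebra
begin

lift_definition zero_oppair :: "'a oppair" is "0" .
lift_definition plus_oppair :: "'a oppair \<Rightarrow> 'a oppair \<Rightarrow> 'a oppair" is "(+)" .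
lift_definition minus_oppair :: "'a oppair \<Rightarrow> 'a oppair \<Rightarrow> 'a oppair" is "(-)" .
lift_definition uminus_oppair :: "'a oppair \<Rightarrow> 'a oppair" is "uminus" .
lift_definition scaleR_oppair :: "real \<Rightarrow> 'a oppair \<Rightarrow> 'a oppair" is "scaleR" .
lift_definition times_oppair :: "'a oppair \<Rightarrow> 'a oppair \<Rightarrow> 'a oppair"
  is "\<lambda>(S, S') (T, T'). (S o\<^sub>L T, T' o\<^sub>L S')" .
lift_definition norm_oppair :: "'a oppair \<Rightarrow> real" is "\<lambda>(T, T'). max (norm T) (norm T')" .
definition sgn_oppair :: "'a oppair \<Rightarrow> 'a oppair" where "sgn_oppair T = inverse (norm T) *\<^sub>R T"
definition dist_oppair :: "'a oppair \<Rightarrow> 'a oppair \<Rightarrow> real" where "dist_oppair S T = norm (S - T)"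
definition uniformity_oppair :: "('a oppair \<times> 'a oppair) filter"
  where "uniformity_oppair = (INF e\<in>{0<..}. principal {(x, y). dist x y < e})"
definition open_oppair :: "'a oppair set \<Rightarrow> bool"
  where "open_oppair U \<longleftrightarrow> (\<forall>x\<in>U. \<forall>\<^sub>F (x', y) in uniformity. x' = x \<longrightarrow> y \<in> U)"

instance
proof
  fix a b c :: "'a oppair" and r s :: real
  show "a + b + c = a + (b + c)" "a + b = b + a" "0 + a = a" "- a + a = 0" "a - b = a + - b"
    "r *\<^sub>R (a + b) = r *\<^sub>R a + r *\<^sub>R b" "(r + s) *\<^sub>R a = r *\<^sub>R a + s *\<^sub>R a"
    "r *\<^sub>R s *\<^sub>R a = (r * s) *\<^sub>R a" "1 *\<^sub>R a = a"
    by (transfer; simp add: algebra_simps)+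
  show "a * b * c = a * (b * c)"
    by transfer (auto intro!: blinfun_eqI)
  show "(a + b) * c = a * c + b * c" "a * (b + c) = a * b + a * c"
    by (transfer; auto intro!: blinfun_eqI simp: blinfun.bilinear_simps)+
  show "r *\<^sub>R a * b = r *\<^sub>R (a * b)" "a * r *\<^sub>R b = r *\<^sub>R (a * b)"
    by (transfer; auto intro!: blinfun_eqI simp: blinfun.bilinear_simps)+
  show "norm a = 0 \<longleftrightarrow> a = 0"
    by transfer (auto simp: max_def zero_prod_def split: if_splits)
  show "norm (a + b) \<le> norm a + norm b"
    by transfer (auto intro!: max.boundedI order_trans[OF norm_triangle_ineq] add_mono)
  show "norm (r *\<^sub>R a) = \<bar>r\<bar> * norm a"
    by transfer (auto simp: max_mult_distrib_left)
  show "norm (a * b) \<le> norm a * norm b"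
    by transfer (simp only: case_prod_beta fst_conv snd_conv norm_blinfun_compose_swap_le)
qed (simp_all add: sgn_oppair_def dist_oppair_def uniformity_oppair_def open_oppair_def)

end

instantiation oppair :: (banach) star_banach_algebra
begin

lift_definition one_oppair :: "'a oppair" is "(id_blinfun, id_blinfun)" .
lift_definition adj_oppair :: "'a oppair \<Rightarrow> 'a oppair" is "\<lambda>(T, T'). (T', T)" .

instance
proof
  fix X :: "nat \<Rightarrow> 'a oppair"
  assume X: "Cauchy X"
  define F where "F n = fst (Rep_oppair (X n))" for n
  define G where "G n = snd (Rep_oppair (X n))" for n
  have nd: "dist (X m) T = max (dist (F m) (fst (Rep_oppair T))) (dist (G m) (snd (Rep_oppair T)))"
    for m T
    by (simp add: F_def G_def dist_oppair_def dist_norm norm_oppair.rep_eq minus_oppair.rep_eq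
        case_prod_beta)
  have d: "dist (X m) (X n) = max (dist (F m) (F n)) (dist (G m) (G n))" for m n
    by (simp add: nd F_def G_def)
  have "Cauchy F" "Cauchy G"
    using X unfolding Cauchy_def d max_less_iff_conj by meson+
  then obtain f g where fg: "F \<longlonglongrightarrow> f" "G \<longlonglongrightarrow> g"
    by (auto simp: Cauchy_convergent_iff convergent_def)
  have "(\<lambda>n. max (dist (F n) f) (dist (G n) g)) \<longlonglongrightarrow> max 0 0"
    by (intro tendsto_max fg[THEN tendsto_dist_iff[THEN iffD1]])
  then have "X \<longlonglongrightarrow> Abs_oppair (f, g)"
    by (subst tendsto_dist_iff) (simp add: nd Abs_oppair_inverse)
  then show "convergent X" by (auto simp: convergent_def)
next
  fix a b :: "'a oppair" and r :: real
  show "1 * a = a" "a * 1 = a" by (transfer; auto)+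
  show "adj (a + b) = adj a + adj b" "adj (r *\<^sub>R a) = r *\<^sub>R adj a" "adj (a * b) = adj b * adj a"
    "adj (adj a) = a"
    by (transfer; auto)+
  show "norm (adj a) = norm a" by transfer (auto simp: max.commute)
  show "norm (1 :: 'a oppair) \<le> 1" by transfer (simp add: norm_blinfun_id_le)
qed

end

lift_definition app :: "'x::banach oppair \<Rightarrow> 'x \<Rightarrow> 'x" is "\<lambda>(T, T') x. blinfun_apply T x" .

lemma app_simps:
  "app (S + T) x = app S x + app T x"
  "app (S - T) x = app S x - app T x"
  "app (- T) x = - app T x"
  "app (r *\<^sub>R T) x = r *\<^sub>R app T x"
  "app (S * T) x = app S (app T x)"
  "app 1 x = x"
  "app 0 x = 0"
  "app T (x + y) = app T x + app T y"
  "app T (x - y) = app T x - app T y"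
  "app T (- x) = - app T x"
  "app T (r *\<^sub>R x) = r *\<^sub>R app T x"
  "app T 0 = 0"
  by (transfer; auto simp: blinfun.bilinear_simps zero_prod_def split: prod.splits)+

lemma app_sum: "app (\<Sum>i\<in>I. T i) x = (\<Sum>i\<in>I. app (T i) x)"
  by (induction I rule: infinite_finite_induct) (simp_all add: app_simps)

lemma norm_app_le: "norm (app T x) \<le> norm T * norm x"
  by transfer (auto split: prod.splits intro!: order_trans[OF norm_blinfun] mult_right_mono)

lemma bounded_linear_app: "bounded_linear (\<lambda>T. app T x)"
  by (rule bounded_linear_intro[where K = "norm x"])
    (simp_all add: app_simps norm_app_le)

lemma oppair_eqI:
  "(\<And>x. app S x = app T x) \<Longrightarrow> (\<And>x. app (adj S) x = app (adj T) x) \<Longrightarrow> S = T"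
  by transfer (auto intro: blinfun_eqI)

lemma norm_oppair_le:
  "(\<And>x. norm (app T x) \<le> K * norm x) \<Longrightarrow> (\<And>x. norm (app (adj T) x) \<le> K * norm x) \<Longrightarrow> 0 \<le> K
    \<Longrightarrow> norm T \<le> K"
  by transfer (auto intro!: norm_blinfun_bound)

lift_definition oppair_of :: "('x::banach \<Rightarrow> 'x) \<Rightarrow> ('x \<Rightarrow> 'x) \<Rightarrow> 'x oppair"
  is "\<lambda>f g. (Blinfun f, Blinfun g)" .

lemma app_oppair_of:
  "bounded_linear f \<Longrightarrow> app (oppair_of f g) = f"
  "bounded_linear g \<Longrightarrow> app (adj (oppair_of f g)) = g"
  by (transfer; simp add: bounded_linear_Blinfun_apply)+

section \<open>Hilbert modules and adjointable operators\<close>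

instance cbanach \<subseteq> banach ..

lemma star_minus: "star (- a) = - star (a::'a::cstar_algebra)"
  using star_scaleC[of "-1" a] scaleR_scaleC[of "-1" a] scaleR_scaleC[of "-1" "star a"] by simp

lemma star_diff: "star (a - b) = star a - star (b::'a::cstar_algebra)"
  using star_add[of a "- b"] by (simp add: star_minus)

lemma star_scaleR: "star (r *\<^sub>R a) = r *\<^sub>R star (a::'a::cstar_algebra)"
  by (simp add: scaleR_scaleC star_scaleC)

lemma norm_star: "norm (star a) = norm (a::'a::cstar_algebra)"
proof -
  have "norm b \<le> norm (star b)" for b :: 'a
  proof -
    have "norm b * norm b \<le> norm (star b) * norm b"
      using norm_star_mult_self[of b] norm_mult_ineq[of "star b" b] by (simp add: power2_eq_square)
    then show ?thesis by (cases "b = 0") auto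
  qed
  from this[of a] this[of "star a"] show ?thesis by (simp add: star_star)
qed

lemma scaleC_i_i: "\<i> *\<^sub>C \<i> *\<^sub>C a = - (a::'a::complex_vector)"
  using scaleR_scaleC[of "-1" a] by (simp add: scaleC_scaleC)

lemma norm_scaleC_i: "norm (\<i> *\<^sub>C a) = norm (a::'a::complex_normed_vector)"
  by (simp add: norm_scaleC)

text \<open>The map \<open>J\<close> stands for multiplication by \<open>\<i>\<close>. Keeping it as a parameter lets a left module be
  read as a right module over the same algebra, with action \<open>y \<cdot> a = a\<^sup>* y\<close> and \<open>J = - \<i>\<close>.\<close>

locale hilbert_form =
  fixes act :: "'x::banach \<Rightarrow> 'a::cstar_algebra \<Rightarrow> 'x"
    and ip :: "'x \<Rightarrow> 'x \<Rightarrow> 'a"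
    and J :: "'x \<Rightarrow> 'x"
  assumes ip_add_right: "ip x (y + z) = ip x y + ip x z"
    and ip_scaleR_right: "ip x (r *\<^sub>R y) = r *\<^sub>R ip x y"
    and ip_J_right: "ip x (J y) = \<i> *\<^sub>C ip x y"
    and ip_act_right: "ip x (act y a) = ip x y * a"
    and star_ip: "star (ip x y) = ip y x"
    and ip_positive: "cstar_positive (ip x x)"
    and norm_ip: "(norm x)\<^sup>2 = norm (ip x x)"
begin

lemma ip_minus_right: "ip x (- y) = - ip x y"
  using ip_scaleR_right[of x "-1" y] by simp

lemma ip_diff_right: "ip x (y - z) = ip x y - ip x z"
  using ip_add_right[of x y "- z"] by (simp add: ip_minus_right)

lemma ip_add_left: "ip (x + y) z = ip x z + ip y z"
  by (metis star_ip ip_add_right star_add)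

lemma ip_scaleR_left: "ip (r *\<^sub>R x) y = r *\<^sub>R ip x y"
  by (metis star_ip ip_scaleR_right star_scaleR)

lemma ip_minus_left: "ip (- x) y = - ip x y"
  using ip_scaleR_left[of "-1" x y] by simp

lemma ip_diff_left: "ip (x - y) z = ip x z - ip y z"
  using ip_add_left[of x "- y" z] by (simp add: ip_minus_left)

lemma ip_zero_right [simp]: "ip x 0 = 0"
  using ip_scaleR_right[of x 0 0] by simp

lemma ip_act_left: "ip (act x a) y = star a * ip x y"
  by (metis star_ip ip_act_right star_mult)

lemma ip_J_left: "ip (J x) y = - (\<i> *\<^sub>C ip x y)"
proof -
  have "ip (J x) y = star (\<i> *\<^sub>C ip y x)" by (metis star_ip ip_J_right)
  also have "\<dots> = (- 1) *\<^sub>C (\<i> *\<^sub>C ip x y)"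
    by (simp add: star_scaleC star_ip scaleC_scaleC)
  also have "\<dots> = - (\<i> *\<^sub>C ip x y)"
    using scaleR_scaleC[of "-1" "\<i> *\<^sub>C ip x y"] by simp
  finally show ?thesis .
qed

lemma ip_eqI:
  assumes "\<And>z. ip z x = ip z y"
  shows "x = y"
proof -
  have "(norm (x - y))\<^sup>2 = 0"
    unfolding norm_ip by (simp add: ip_diff_right assms)
  then show ?thesis by simp
qed

lemma norm_act_le: "norm (act x a) \<le> norm x * norm a"
proof (rule power2_le_imp_le)
  have "(norm (act x a))\<^sup>2 = norm (star a * ip x x * a)"
    by (simp add: norm_ip ip_act_right ip_act_left mult.assoc)
  also have "\<dots> \<le> norm (star a) * norm (ip x x) * norm a"
    by (smt (verit) mult_right_mono norm_ge_zero norm_mult_ineq)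
  also have "\<dots> = (norm x * norm a)\<^sup>2"
    by (simp add: norm_star norm_ip[symmetric] power2_eq_square)
  finally show "(norm (act x a))\<^sup>2 \<le> (norm x * norm a)\<^sup>2" .
qed simp

lemma norm_J: "norm (J x) = norm x"
proof -
  have "ip (J x) (J x) = \<i> *\<^sub>C - (\<i> *\<^sub>C ip x x)" by (simp add: ip_J_left ip_J_right)
  then have "(norm (J x))\<^sup>2 = (norm x)\<^sup>2" by (simp add: norm_ip norm_scaleC_i)
  then show ?thesis by simp
qed

end

text \<open>Cauchy-Schwarz is first an assumption, so that the operator theory can be applied to the
  algebra as a module over itself, where it is submultiplicativity of the norm. The order theory
  obtained there then yields it for every \<open>hilbert_form\<close>.\<close>

locale hilbert_form_cs = hilbert_form +
  assumes norm_ip_le: "norm (ip x y) \<le> norm x * norm y"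
begin

section \<open>Adjointable operators\<close>

definition adjointable :: "'a oppair set" where
  "adjointable = {T. \<forall>x y. ip (app T x) y = ip x (app (adj T) y)}"

lemma adjointableD: "T \<in> adjointable \<Longrightarrow> ip (app T x) y = ip x (app (adj T) y)"
  by (simp add: adjointable_def)

lemma adjointable_adj: "T \<in> adjointable \<Longrightarrow> adj T \<in> adjointable"
  unfolding adjointable_def by simp (metis star_ip)

lemma adjointable_eqI:
  assumes "S \<in> adjointable" "T \<in> adjointable" "\<And>x. app S x = app T x"
  shows "S = T"
proof (rule oppair_eqI[OF assms(3)])
  show "app (adj S) x = app (adj T) x" for x
    by (rule ip_eqI) (metis adjointableD assms)
qed

text \<open>Linearity of both maps follows from nondegeneracy of the form, and the bound for
  \<open>g\<close> from Cauchy-Schwarz applied to \<open>ip (f (g y)) y\<close>.\<close>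

lemma oppair_of_adjointable:
  assumes fg: "\<And>x y. ip (f x) y = ip x (g y)" and K: "\<And>x. norm (f x) \<le> K * norm x"
  shows "oppair_of f g \<in> adjointable" "app (oppair_of f g) = f" "app (adj (oppair_of f g)) = g"
proof -
  have gf: "ip (g x) y = ip x (f y)" for x y by (metis fg star_ip)
  have lin: "bounded_linear h" if h: "\<And>x y. ip (k x) y = ip x (h y)" and b: "\<And>x. norm (h x) \<le> K * norm x"
    for h k
  proof (rule bounded_linear_intro[where K = K])
    show "h (x + y) = h x + h y" for x y
      by (rule ip_eqI) (simp add: h[symmetric] ip_add_right)
    show "h (r *\<^sub>R x) = r *\<^sub>R h x" for r x
      by (rule ip_eqI) (simp add: h[symmetric] ip_scaleR_right)
    show "norm (h x) \<le> norm x * K" for x using b[of x] by (simp add: mult.commute)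
  qed
  have g: "norm (g y) \<le> K * norm y" for y
  proof (cases "g y = 0")
    case True
    have "0 \<le> K * norm y" using K[of y] norm_ge_zero order_trans by blast
    then show ?thesis using True by simp
  next
    case False
    have "(norm (g y))\<^sup>2 = norm (ip (f (g y)) y)" by (simp add: norm_ip fg)
    also have "\<dots> \<le> norm (f (g y)) * norm y" by (rule norm_ip_le)
    also have "\<dots> \<le> K * norm (g y) * norm y" by (intro mult_right_mono K) simp
    finally have "norm (g y) * norm (g y) \<le> norm (g y) * (K * norm y)"
      by (simp add: power2_eq_square mult_ac)
    then show ?thesis using False by simp
  qed
  show f1: "app (oppair_of f g) = f" and g1: "app (adj (oppair_of f g)) = g"
    by (intro app_oppair_of lin[OF gf K] lin[OF fg g])+
  show "oppair_of f g \<in> adjointable"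
    by (simp add: adjointable_def f1 g1 fg)
qed

definition J_op :: "'a oppair" where "J_op = oppair_of J (\<lambda>x. - J x)"

lemma J_op: "J_op \<in> adjointable" "app J_op = J" "app (adj J_op) = (\<lambda>x. - J x)"
  unfolding J_op_def
  by (rule oppair_of_adjointable[where K = 1];
      simp add: ip_J_left ip_J_right ip_minus_right norm_J)+

lemma ip_bounded_linear_right: "bounded_linear (ip x)"
  by (rule bounded_linear_intro[where K = "norm x"])
    (simp_all add: ip_add_right ip_scaleR_right norm_ip_le mult.commute[of "norm (_::'a)" "norm x"])

lemma ip_bounded_linear_left: "bounded_linear (\<lambda>x. ip x y)"
  by (rule bounded_linear_intro[where K = "norm y"])
    (simp_all add: ip_add_left ip_scaleR_left norm_ip_le)

lemma closed_adjointable: "closed adjointable"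
proof -
  have "closed {T. ip (app T x) y = ip x (app (adj T) y)}" for x y
    by (intro closed_Collect_eq linear_continuous_on
        bounded_linear_compose[OF ip_bounded_linear_left]
        bounded_linear_compose[OF ip_bounded_linear_right]
        bounded_linear_compose[OF bounded_linear_app] bounded_linear_app bounded_linear_adj)
  then have "closed (\<Inter>x. \<Inter>y. {T. ip (app T x) y = ip x (app (adj T) y)})"
    by (intro closed_INT ballI)
  moreover have "adjointable = (\<Inter>x. \<Inter>y. {T. ip (app T x) y = ip x (app (adj T) y)})"
    by (auto simp: adjointable_def)
  ultimately show ?thesis by simp
qed

text \<open>The norm of a pair is a maximum, so the square root \<open>s\<close> of the left side
  has to bound both components; the bound for the adjoint follows from that for \<open>T\<close> by
  Cauchy-Schwarz.\<close>

lemma norm_adjointable: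
  assumes T: "T \<in> adjointable"
  shows "norm (adj T * T) = (norm T)\<^sup>2"
proof (rule antisym)
  show "norm (adj T * T) \<le> (norm T)\<^sup>2"
    using norm_mult_ineq[of "adj T" T] by (simp add: norm_adj power2_eq_square)
  define s where "s = sqrt (norm (adj T * T))"
  have s: "s \<ge> 0" "s\<^sup>2 = norm (adj T * T)" by (simp_all add: s_def)
  have b: "norm (app T x) \<le> s * norm x" for x
  proof (rule power2_le_imp_le)
    have "(norm (app T x))\<^sup>2 = norm (ip x (app (adj T * T) x))"
      by (simp add: norm_ip adjointableD[OF T] app_simps)
    also have "\<dots> \<le> norm x * (norm (adj T * T) * norm x)"
      by (rule order_trans[OF norm_ip_le]) (intro mult_left_mono norm_app_le norm_ge_zero)
    also have "\<dots> = (s * norm x)\<^sup>2"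
      unfolding power_mult_distrib s(2) by (simp add: power2_eq_square)
    finally show "(norm (app T x))\<^sup>2 \<le> (s * norm x)\<^sup>2" .
  qed (simp add: s)
  have b': "norm (app (adj T) x) \<le> s * norm x" for x
  proof (cases "app (adj T) x = 0")
    case False
    have "(norm (app (adj T) x))\<^sup>2 = norm (ip (app T (app (adj T) x)) x)"
      by (simp add: norm_ip adjointableD[OF T])
    also have "\<dots> \<le> s * norm (app (adj T) x) * norm x"
      by (rule order_trans[OF norm_ip_le]) (intro mult_right_mono b norm_ge_zero)
    finally have "norm (app (adj T) x) * norm (app (adj T) x) \<le> norm (app (adj T) x) * (s * norm x)"
      by (simp add: power2_eq_square mult_ac)
    then show ?thesis using False by simp
  qed (simp add: s)
  have "norm T \<le> s" by (rule norm_oppair_le[OF b b' s(1)])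
  then show "(norm T)\<^sup>2 \<le> norm (adj T * T)"
    unfolding s(2)[symmetric] by (intro power_mono) auto
qed

lemma cstar_carrier_adjointable: "cstar_carrier adjointable J_op"
proof
  show "1 \<in> adjointable" by (simp add: adjointable_def app_simps)
  show mult: "S * T \<in> adjointable" if "S \<in> adjointable" "T \<in> adjointable" for S T
    using that by (simp add: adjointable_def app_simps adj_mult)
  have JJ: "J (J x) = - x" for x
    by (rule ip_eqI) (simp add: ip_J_right ip_minus_right scaleC_i_i)
  show "J_op * J_op = - 1"
    by (rule oppair_eqI)
      (simp_all add: app_simps J_op adj_mult adj_minus JJ,
       metis JJ J_op(2) app_simps(10) minus_equation_iff)
  show "adj J_op = - J_op"
    by (rule oppair_eqI) (simp_all add: app_simps J_op adj_minus)
  show "J_op * T = T * J_op" if T: "T \<in> adjointable" for T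
  proof (rule adjointable_eqI[OF mult mult])
    have "J (app T x) = app T (J x)" for x
    proof (rule ip_eqI)
      fix z
      have "ip z (app T y) = ip (app (adj T) z) y" for y
        using adjointableD[OF adjointable_adj[OF T]] by simp
      then show "ip z (J (app T x)) = ip z (app T (J x))"
        by (simp add: ip_J_right)
    qed
    then show "app (J_op * T) x = app (T * J_op) x" for x by (simp add: app_simps J_op)
  qed (use T J_op in auto)
  show "S + T \<in> adjointable" if "S \<in> adjointable" "T \<in> adjointable" for S T
    using that by (simp add: adjointable_def app_simps adj_add ip_add_left ip_add_right)
  show "r *\<^sub>R T \<in> adjointable" if "T \<in> adjointable" for r T
    using that by (simp add: adjointable_def app_simps adj_scaleR ip_scaleR_left ip_scaleR_right)
qed (simp_all add: closed_adjointable J_op adjointable_adj norm_adjointable)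

sublocale cstar_carrier adjointable J_op
  by (rule cstar_carrier_adjointable)

text \<open>Module linearity is automatic: tested against the form, the operator moves to the other
  argument.\<close>

lemma app_act: "T \<in> adjointable \<Longrightarrow> app T (act x a) = act (app T x) a"
  by (rule ip_eqI) (metis adjointableD adjointable_adj adj_adj ip_act_right)

section \<open>Rank-one operators\<close>

definition theta :: "'a \<Rightarrow> 'a oppair" where
  "theta x = oppair_of (\<lambda>y. act x (ip x y)) (\<lambda>y. act x (ip x y))"

lemma theta: "theta x \<in> adjointable" "app (theta x) = (\<lambda>y. act x (ip x y))" "adj (theta x) = theta x"
proof -
  have 1: "ip (act x (ip x y)) z = ip y (act x (ip x z))" for y z
    by (simp add: ip_act_left ip_act_right star_ip)
  have 2: "norm (act x (ip x y)) \<le> (norm x * norm x) * norm y" for y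
    by (rule order_trans[OF norm_act_le]) (simp add: mult.assoc mult_left_mono norm_ip_le)
  note * = oppair_of_adjointable[of "\<lambda>y. act x (ip x y)" "\<lambda>y. act x (ip x y)", OF 1 2]
  show "theta x \<in> adjointable" "app (theta x) = (\<lambda>y. act x (ip x y))"
    unfolding theta_def by (fact *)+
  show "adj (theta x) = theta x"
    unfolding theta_def by (rule oppair_eqI) (simp_all add: *)
qed

lemma theta_SA: "theta x \<in> SA"
  by (simp add: SA_def theta)

lemma theta_app:
  assumes T: "T \<in> adjointable"
  shows "theta (app T x) = T * theta x * adj T"
  by (rule adjointable_eqI)
    (use T in \<open>auto simp: theta app_simps app_act adjointableD intro!: mult_C adj_C\<close>)

text \<open>At \<open>x\<close> the form \<open>ip x (app (theta x) x)\<close> is the square of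
  \<open>ip x x\<close>, of norm \<open>norm x\<close> to the fourth power; Cauchy-Schwarz bounds it
  by \<open>norm (theta x)\<close> times the square of \<open>norm x\<close>.\<close>

lemma norm_theta_ge: "(norm x)\<^sup>2 \<le> norm (theta x)"
proof (cases "x = 0")
  case False
  have "ip x (app (theta x) x) = ip x x * ip x x" by (simp add: theta ip_act_right)
  moreover have "norm (ip x x * ip x x) = (norm (ip x x))\<^sup>2"
    using norm_star_mult_self[of "ip x x"] by (simp add: star_ip)
  ultimately have "(norm (ip x x))\<^sup>2 \<le> norm x * norm (app (theta x) x)"
    using norm_ip_le[of x "app (theta x) x"] by simp
  also have "\<dots> \<le> norm x * (norm (theta x) * norm x)" by (intro mult_left_mono norm_app_le) simp
  finally have "(norm x)\<^sup>2 * (norm x)\<^sup>2 \<le> (norm x)\<^sup>2 * norm (theta x)"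
    by (simp add: norm_ip[symmetric] power2_eq_square mult_ac)
  then show ?thesis
    using False by (metis mult_le_cancel_left_pos zero_less_norm_iff zero_less_power)
qed simp

end

section \<open>Left multiplications of the algebra and the Cauchy-Schwarz inequality\<close>

interpretation alg: hilbert_form_cs "(*)" "\<lambda>a b. star a * b" "scaleC \<i> :: 'a \<Rightarrow> 'a::cstar_algebra"
proof
  fix x y z a :: 'a and r :: real
  show "star x * (y + z) = star x * y + star x * z" by (rule distrib_left)
  show "star x * r *\<^sub>R y = r *\<^sub>R (star x * y)" by simp
  show "star x * \<i> *\<^sub>C y = \<i> *\<^sub>C (star x * y)" by (rule mult_scaleC_right)
  show "star x * (y * a) = star x * y * a" by (rule mult.assoc[symmetric])
  show "star (star x * y) = star y * x" by (simp add: star_mult star_star)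
  show "cstar_positive (star x * x)" by (auto simp: cstar_positive_def)
  show "(norm x)\<^sup>2 = norm (star x * x)" by (simp add: norm_star_mult_self)
  show "norm (star x * y) \<le> norm x * norm y" using norm_mult_ineq[of "star x" y] by (simp add: norm_star)
qed

text \<open>The algebra may lack a unit; its left multiplications lie in a unital algebra to which
  the order theory applies, and the embedding is isometric by \<open>norm_left_mult\<close>.\<close>

definition left_mult :: "'a::cstar_algebra \<Rightarrow> 'a oppair" where
  "left_mult a = oppair_of (\<lambda>b. a * b) (\<lambda>b. star a * b)"

lemma left_mult: "left_mult a \<in> alg.adjointable" "app (left_mult a) = (\<lambda>b. a * b)"
    "adj (left_mult a) = left_mult (star a)"
proof -
  have 1: "star (a * x) * y = star x * (star a * y)" for a x y :: 'a
    by (simp add: star_mult mult.assoc)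
  note * = alg.oppair_of_adjointable[of "\<lambda>b. a * b" "\<lambda>b. star a * b" "norm a" for a, OF 1 norm_mult_ineq]
  show "left_mult a \<in> alg.adjointable" unfolding left_mult_def by (fact *)
  have l: "app (left_mult a) = (\<lambda>b. a * b)" "app (adj (left_mult a)) = (\<lambda>b. star a * b)" for a :: 'a
    unfolding left_mult_def by (fact *)+
  show "app (left_mult a) = (\<lambda>b. a * b)" by (fact l)
  show "adj (left_mult a) = left_mult (star a)"
    by (rule oppair_eqI) (simp_all add: l star_star)
qed

lemma left_mult_add: "left_mult (a + b) = left_mult a + left_mult b"
  and left_mult_diff: "left_mult (a - b) = left_mult a - left_mult b"
  and left_mult_mult: "left_mult (a * b) = left_mult a * left_mult b"
  by (rule oppair_eqI;
      simp add: left_mult app_simps adj_add adj_diff adj_mult star_add star_diff star_mult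
        algebra_simps mult.assoc)+

lemma norm_left_mult: "norm (left_mult a) = norm a"
proof (rule antisym)
  show "norm (left_mult a) \<le> norm a"
    using norm_mult_ineq[of "star a"]
    by (intro norm_oppair_le) (simp_all add: left_mult norm_mult_ineq norm_star)
  \<comment> \<open>Testing on \<open>star a\<close> gives the lower bound, by the
    C*-identity.\<close>
  have "norm (app (left_mult a) (star a)) \<le> norm (left_mult a) * norm (star a)"
    by (rule norm_app_le)
  then have "norm a * norm a \<le> norm (left_mult a) * norm a"
    using norm_star_mult_self[of "star a"] by (simp add: left_mult star_star norm_star power2_eq_square)
  then show "norm a \<le> norm (left_mult a)" by (cases "a = 0") auto
qed

lemma pos_left_mult: "alg.pos (left_mult (star a * a))"
  using alg.pos_adj_mult[OF left_mult(1)[of a]] by (simp add: left_mult_mult left_mult)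

lemma star_mult_self_sum_zero:
  fixes a b :: "'a::cstar_algebra"
  assumes "star a * a + star b * b = 0"
  shows "a = 0"
proof -
  have "left_mult (star b * b) = - left_mult (star a * a)"
    using left_mult_add[of "star a * a" "star b * b"] assms left_mult_diff[of a a]
    by (simp add: eq_neg_iff_add_eq_0 add.commute)
  then have "left_mult (star a * a) = 0"
    using alg.pos_neg_zero pos_left_mult by metis
  then have "norm (star a * a) = 0" using norm_left_mult[of "star a * a"] by simp
  then show ?thesis using norm_star_mult_self[of a] by simp
qed

text \<open>Among left multiplications, \<open>q - star b * b\<close> becomes
  \<open>star e * e\<close> plus a conjugate of \<open>1 - star c * c\<close>, which is positive for
  \<open>norm c \<le> 1\<close>; the norm is monotone on positive elements.\<close>

lemma norm_le_of_star_mult_sum: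
  fixes b c e :: "'a::cstar_algebra"
  assumes c: "norm c \<le> 1" and q: "q = star b * b + star e * e + (star b * b - star b * (star c * c) * b)"
  shows "(norm b)\<^sup>2 \<le> norm q"
proof -
  have "norm (left_mult (star c * c)) \<le> 1"
    using c by (simp add: norm_left_mult norm_star_mult_self power_le_one)
  then have "alg.pos (1 - left_mult (star c * c))"
    using alg.pos_norm_minus[OF pos_left_mult, of c 1] by simp
  then have "alg.pos (adj (left_mult b) * (1 - left_mult (star c * c)) * left_mult b)"
    by (intro alg.pos_conj left_mult)
  moreover have "left_mult q - left_mult (star b * b) = left_mult (star e * e)
      + adj (left_mult b) * (1 - left_mult (star c * c)) * left_mult b"
    unfolding q by (simp add: left_mult_add left_mult_diff left_mult_mult left_mult algebra_simps mult.assoc)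
  ultimately have "alg.pos (left_mult q - left_mult (star b * b))"
    using alg.pos_add[OF pos_left_mult] by simp
  then have "norm (left_mult (star b * b)) \<le> norm (left_mult q)"
    by (rule alg.pos_norm_mono[OF pos_left_mult])
  then show ?thesis by (simp add: norm_left_mult norm_star_mult_self)
qed

text \<open>For b = (x|y) and w = y - x b, expanding (w|w) and solving for (y|y) gives the shape
  treated in \<open>norm_le_of_star_mult_sum\<close>.\<close>

lemma (in hilbert_form) norm_ip_le_unit:
  assumes "norm x \<le> 1"
  shows "norm (ip x y) \<le> norm y"
proof -
  define b where "b = ip x y"
  define w where "w = y - act x b"
  obtain c where c: "ip x x = star c * c" using ip_positive by (auto simp: cstar_positive_def)
  obtain e where e: "ip w w = star e * e" using ip_positive by (auto simp: cstar_positive_def)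
  have "(norm c)\<^sup>2 \<le> 1"
    using assms norm_ip[of x] by (simp add: c norm_star_mult_self power_le_one)
  then have nc: "norm c \<le> 1" by (simp add: power2_le_iff_abs_le[of 1, simplified])
  have yx: "ip y x = star b" by (simp add: b_def star_ip)
  have "ip y y = star b * b + ip w w + (star b * b - star b * ip x x * b)"
    unfolding w_def
    by (simp add: ip_diff_left ip_diff_right ip_act_left ip_act_right b_def[symmetric] yx
        right_diff_distrib left_diff_distrib mult.assoc)
  then have "(norm b)\<^sup>2 \<le> norm (ip y y)"
    unfolding c e by (rule norm_le_of_star_mult_sum[OF nc])
  then show ?thesis unfolding b_def by (simp add: norm_ip[symmetric])
qed

lemma (in hilbert_form) hilbert_form_cs: "hilbert_form_cs act ip J"
proof
  show "norm (ip x y) \<le> norm x * norm y" for x y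
  proof (cases "x = 0")
    case True
    then have "ip x y = 0" by (metis ip_scaleR_left scaleR_zero_left)
    then show ?thesis by simp
  next
    case False
    then have "norm (ip (inverse (norm x) *\<^sub>R x) y) \<le> norm y" by (intro norm_ip_le_unit) simp
    then show ?thesis using False by (simp add: ip_scaleR_left field_simps)
  qed
qed

section \<open>Positivity of rank-one operators and construction of the basis\<close>

context hilbert_form_cs
begin

text \<open>With \<open>n\<close>, \<open>m\<close> as in \<open>negative_part\<close> the value \<open>(y | n \<theta>\<^sub>x n y)\<close> equals both \<open>v\<^sup>* v\<close>, for
  \<open>v = (x | n y)\<close>, and \<open>- (m y | m y)\<close>; this forces \<open>m = 0\<close>.\<close>

lemma pos_theta: "pos (theta x)"
proof -
  obtain n m where nm: "n \<in> SA" "m \<in> SA" "n * theta x * n = - (m * m)" "m = 0 \<longrightarrow> pos (theta x)"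
    by (rule negative_part[OF theta_SA])
  have "app m y = 0" for y
  proof -
    define v where "v = ip x (app n y)"
    obtain e where e: "ip (app m y) (app m y) = star e * e"
      using ip_positive by (auto simp: cstar_positive_def)
    have SAD: "ip (app k a) b = ip a (app k b)" if "k \<in> SA" for k a b
      using adjointableD[OF SA_C[OF that]] by (simp add: SA_adj[OF that])
    have "ip y (app (n * theta x * n) y) = star v * v"
      by (simp add: app_simps theta SAD[OF nm(1), symmetric] ip_act_right v_def star_ip)
    moreover have "ip y (app (- (m * m)) y) = - (star e * e)"
      by (simp add: app_simps ip_minus_right SAD[OF nm(2), of y "app m y", symmetric] e)
    ultimately have "- (star e * e) = star v * v" using nm(3) by simp
    then have "star e * e + star v * v = 0" by (metis add.right_inverse)
    then have "e = 0" by (rule star_mult_self_sum_zero)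
    then have "(norm (app m y))\<^sup>2 = 0" by (simp add: norm_ip e)
    then show ?thesis by simp
  qed
  then have "m = 0"
    by (intro adjointable_eqI) (simp_all add: nm(2) SA_C app_simps)
  then show ?thesis using nm(4) by simp
qed

lemma ip_app_SA: "T \<in> SA \<Longrightarrow> ip x (app (T * T) x) = ip (app T x) (app T x)"
  using adjointableD[OF SA_C, of T x "app T x"] by (simp add: SA_adj app_simps)

lemma cstar_positive_ip_app: "pos T \<Longrightarrow> cstar_positive (ip x (app T x))"
  unfolding pos_def by (auto simp: ip_app_SA ip_positive)

text \<open>The factor \<open>card\<close> makes the resolvent small on each vector of a large
  \<open>\<mu>\<close>; see \<open>norm_app_resolvent_le\<close>.\<close>

definition weighted_theta :: "'a set \<Rightarrow> 'a oppair" where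
  "weighted_theta \<mu> = real (card \<mu>) *\<^sub>R (\<Sum>x\<in>\<mu>. theta x)"

lemma pos_weighted_theta: "pos (weighted_theta \<mu>)"
  unfolding weighted_theta_def by (intro pos_scaleR pos_sum pos_theta) simp

text \<open>Both the weight and the sum grow: the difference is the increase of \<open>card\<close>
  times the old sum, plus \<open>card \<nu>\<close> times the sum over
  \<open>\<nu> - \<mu>\<close>.\<close>

lemma weighted_theta_mono:
  assumes "finite \<nu>" "\<mu> \<subseteq> \<nu>"
  shows "pos (weighted_theta \<nu> - weighted_theta \<mu>)"
proof -
  have s: "(\<Sum>x\<in>\<nu>. theta x) = (\<Sum>x\<in>\<mu>. theta x) + (\<Sum>x\<in>\<nu> - \<mu>. theta x)"
    using sum.subset_diff[OF assms(2,1), of theta] by (simp add: add.commute)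
  have "card \<mu> \<le> card \<nu>" using assms by (rule card_mono)
  then have "pos ((real (card \<nu>) - real (card \<mu>)) *\<^sub>R (\<Sum>x\<in>\<mu>. theta x)
      + real (card \<nu>) *\<^sub>R (\<Sum>x\<in>\<nu> - \<mu>. theta x))"
    by (intro pos_add pos_scaleR pos_sum pos_theta) simp_all
  then show ?thesis
    by (simp add: weighted_theta_def s algebra_simps)
qed

definition resolvent :: "'a set \<Rightarrow> 'a oppair" where
  "resolvent \<mu> = (SOME b. pos b \<and> b * (1 + weighted_theta \<mu>) = 1 \<and> (1 + weighted_theta \<mu>) * b = 1)"

lemma resolvent:
  "pos (resolvent \<mu>)" "resolvent \<mu> * (1 + weighted_theta \<mu>) = 1"
  "(1 + weighted_theta \<mu>) * resolvent \<mu> = 1"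
proof -
  have "\<exists>b. pos b \<and> b * (1 + weighted_theta \<mu>) = 1 \<and> (1 + weighted_theta \<mu>) * b = 1"
    using inverse_one_plus[OF pos_weighted_theta] by metis
  from someI_ex[OF this] show "pos (resolvent \<mu>)" "resolvent \<mu> * (1 + weighted_theta \<mu>) = 1"
    "(1 + weighted_theta \<mu>) * resolvent \<mu> = 1"
    unfolding resolvent_def by blast+
qed

definition sqrt_resolvent :: "'a set \<Rightarrow> 'a oppair" where
  "sqrt_resolvent \<mu> = (SOME r. pos r \<and> resolvent \<mu> = r * r
    \<and> (\<forall>z. z * resolvent \<mu> = resolvent \<mu> * z \<longrightarrow> z * r = r * z))"

lemma sqrt_resolvent:
  "pos (sqrt_resolvent \<mu>)" "resolvent \<mu> = sqrt_resolvent \<mu> * sqrt_resolvent \<mu>"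
  "z * resolvent \<mu> = resolvent \<mu> * z \<Longrightarrow> z * sqrt_resolvent \<mu> = sqrt_resolvent \<mu> * z"
proof -
  have "\<exists>r. pos r \<and> resolvent \<mu> = r * r
      \<and> (\<forall>z. z * resolvent \<mu> = resolvent \<mu> * z \<longrightarrow> z * r = r * z)"
    using pos_sqrt[OF resolvent(1)] by metis
  from someI_ex[OF this]
  show "pos (sqrt_resolvent \<mu>)" "resolvent \<mu> = sqrt_resolvent \<mu> * sqrt_resolvent \<mu>"
    "z * resolvent \<mu> = resolvent \<mu> * z \<Longrightarrow> z * sqrt_resolvent \<mu> = sqrt_resolvent \<mu> * z"
    unfolding sqrt_resolvent_def by blast+
qed

lemma weighted_theta_resolvent:
  "weighted_theta \<mu> * resolvent \<mu> = 1 - resolvent \<mu>"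
  "resolvent \<mu> * weighted_theta \<mu> = 1 - resolvent \<mu>"
  using resolvent(2,3)[of \<mu>] by (simp_all add: distrib_left distrib_right eq_diff_eq add.commute)

lemma sqrt_resolvent_conj:
  "sqrt_resolvent \<mu> * weighted_theta \<mu> * sqrt_resolvent \<mu> = 1 - resolvent \<mu>"
proof -
  \<comment> \<open>\<open>weighted_theta\<close> commutes with the resolvent, hence with its square
    root.\<close>
  have "weighted_theta \<mu> * sqrt_resolvent \<mu> = sqrt_resolvent \<mu> * weighted_theta \<mu>"
    by (rule sqrt_resolvent(3)) (simp add: weighted_theta_resolvent)
  then show ?thesis
    by (metis mult.assoc sqrt_resolvent(2) weighted_theta_resolvent(1))
qed

lemma pos_one_minus_resolvent: "pos (1 - resolvent \<mu>)"
  using pos_conj_SA[OF pos_weighted_theta pos_SA[OF sqrt_resolvent(1)], of \<mu> \<mu>]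
  by (simp only: sqrt_resolvent_conj)

lemma resolvent_antimono:
  assumes "finite \<nu>" "\<mu> \<subseteq> \<nu>"
  shows "pos (resolvent \<mu> - resolvent \<nu>)"
  using inverse_antimono[OF weighted_theta_mono[OF assms] resolvent resolvent] .

definition basis_op :: "'a set \<Rightarrow> 'a oppair" where
  "basis_op \<mu> = sqrt (card \<mu>) *\<^sub>R sqrt_resolvent \<mu>"

lemma basis_op: "basis_op \<mu> \<in> adjointable" "adj (basis_op \<mu>) = basis_op \<mu>"
  using SA_scaleR[OF pos_SA[OF sqrt_resolvent(1)]] by (auto simp: basis_op_def SA_def)

lemma inj_basis_op:
  assumes "finite \<mu>" "\<mu> \<noteq> {}"
  shows "inj (app (basis_op \<mu>))"
proof (rule injI)
  fix x y assume "app (basis_op \<mu>) x = app (basis_op \<mu>) y"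
  \<comment> \<open>For the empty set this factor is 0 and \<open>basis_op\<close> vanishes.\<close>
  moreover have "sqrt (card \<mu>) \<noteq> 0" using assms by simp
  ultimately have "app (sqrt_resolvent \<mu>) x = app (sqrt_resolvent \<mu>) y"
    by (simp add: basis_op_def app_simps)
  then have "app (resolvent \<mu>) x = app (resolvent \<mu>) y"
    by (simp add: sqrt_resolvent(2) app_simps)
  then have "app ((1 + weighted_theta \<mu>) * resolvent \<mu>) x = app ((1 + weighted_theta \<mu>) * resolvent \<mu>) y"
    by (simp only: app_simps(5))
  then show "x = y" by (simp only: resolvent(3) app_simps(6))
qed

definition basis :: "'a set \<Rightarrow> 'a set" where
  "basis \<mu> = app (basis_op \<mu>) ` \<mu>"

lemma inj_on_basis_op: "finite \<mu> \<Longrightarrow> inj_on (app (basis_op \<mu>)) \<mu>"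
  by (cases "\<mu> = {}") (auto intro: inj_on_subset[OF inj_basis_op])

text \<open>Injectivity permits reindexing over \<open>\<mu>\<close>, and the two factors
  \<open>sqrt (card \<mu>)\<close> combine to the weight in \<open>weighted_theta\<close>.\<close>

lemma sum_theta_basis:
  assumes "finite \<mu>"
  shows "(\<Sum>y\<in>basis \<mu>. theta y) = 1 - resolvent \<mu>"
proof -
  have "(\<Sum>y\<in>basis \<mu>. theta y) = (\<Sum>x\<in>\<mu>. basis_op \<mu> * theta x * basis_op \<mu>)"
    unfolding basis_def
    by (simp add: sum.reindex[OF inj_on_basis_op[OF assms]] theta_app basis_op)
  also have "\<dots> = basis_op \<mu> * (\<Sum>x\<in>\<mu>. theta x) * basis_op \<mu>"
    by (simp add: sum_distrib_left sum_distrib_right)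
  also have "\<dots> = sqrt_resolvent \<mu> * weighted_theta \<mu> * sqrt_resolvent \<mu>"
    by (simp add: basis_op_def weighted_theta_def)
  finally show ?thesis by (simp only: sqrt_resolvent_conj)
qed

lemma sum_act_basis:
  assumes "finite \<mu>"
  shows "(\<Sum>y\<in>basis \<mu>. act y (ip y x)) = x - app (resolvent \<mu>) x"
proof -
  have "(\<Sum>y\<in>basis \<mu>. act y (ip y x)) = app (\<Sum>y\<in>basis \<mu>. theta y) x"
    by (simp add: app_sum theta)
  then show ?thesis by (simp add: sum_theta_basis[OF assms] app_simps)
qed

lemma sum_ip_basis:
  assumes "finite \<mu>"
  shows "(\<Sum>y\<in>basis \<mu>. ip x y * ip y x) = ip x x - ip x (app (resolvent \<mu>) x)"
proof -
  have "ip x (\<Sum>y\<in>basis \<mu>. act y (ip y x)) = (\<Sum>y\<in>basis \<mu>. ip x y * ip y x)"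
    by (simp add: bounded_linear.linear[OF ip_bounded_linear_right, THEN linear_sum] ip_act_right)
  then show ?thesis by (simp add: sum_act_basis[OF assms] ip_diff_right)
qed

lemma norm_app_resolvent_le:
  assumes \<mu>: "finite \<mu>" "x \<in> \<mu>"
  shows "real (card \<mu>) * (norm (app (resolvent \<mu>) x))\<^sup>2 \<le> 1"
proof -
  define n where "n = real (card \<mu>)"
  define b where "b = resolvent \<mu>"
  have n0: "n \<ge> 0" by (simp add: n_def)
  have b: "b \<in> SA" unfolding b_def by (intro pos_SA resolvent)
  have "weighted_theta \<mu> - n *\<^sub>R theta x = n *\<^sub>R (\<Sum>y\<in>\<mu> - {x}. theta y)"
    by (simp add: weighted_theta_def n_def sum.remove[OF \<mu>] scaleR_add_right)
  then have "pos (weighted_theta \<mu> - n *\<^sub>R theta x)"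
    using n0 by (auto intro: pos_scaleR pos_sum pos_theta)
  then have "pos (b * (weighted_theta \<mu> - n *\<^sub>R theta x) * b)"
    by (rule pos_conj_SA[OF _ b])
  moreover have t: "theta (app b x) = b * theta x * b"
    using theta_app[OF SA_C[OF b]] by (simp add: SA_adj[OF b])
  ultimately have "pos (b * weighted_theta \<mu> * b - n *\<^sub>R theta (app b x))"
    by (simp add: left_diff_distrib right_diff_distrib)
  then have "norm (n *\<^sub>R theta (app b x)) \<le> norm (b * weighted_theta \<mu> * b)"
    using n0 by (intro pos_norm_mono pos_scaleR pos_theta)
  also have "b * weighted_theta \<mu> * b = (1 - b) * b"
    by (simp add: b_def weighted_theta_resolvent)
  \<comment> \<open>\<open>b\<close> and \<open>1 - b\<close> are positive with sum 1, so
    \<open>norm_le_of_pos\<close> bounds each by 1.\<close>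
  also have "norm ((1 - b) * b) \<le> 1 * 1"
  proof (rule order_trans[OF norm_mult_ineq], rule mult_mono)
    show "norm b \<le> 1" "norm (1 - b) \<le> 1"
      unfolding b_def using resolvent(1)[of \<mu>] pos_one_minus_resolvent[of \<mu>]
      by (auto intro: norm_le_of_pos)
  qed simp_all
  finally have "n * norm (theta (app b x)) \<le> 1" using n0 by simp
  moreover have "n * (norm (app b x))\<^sup>2 \<le> n * norm (theta (app b x))"
    by (intro mult_left_mono norm_theta_ge n0)
  ultimately show ?thesis unfolding n_def b_def by linarith
qed

lemma tendsto_sum_act_basis:
  "((\<lambda>\<mu>. \<Sum>y\<in>basis \<mu>. act y (ip y x)) \<longlongrightarrow> x) (finite_subsets_at_top UNIV)"
proof (rule tendstoI)
  fix e :: real assume e: "e > 0"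
  obtain N :: nat where N: "1 / e\<^sup>2 < real N" using reals_Archimedean2 by blast
  have "0 < 1 / e\<^sup>2" using e by simp
  then have N0: "N > 0" using N by (cases "N = 0") auto
  \<comment> \<open>For nonzero \<open>x\<close> these are \<open>N\<close> distinct multiples of
    \<open>x\<close>, the first being \<open>x\<close> itself, so a finite set above
    \<open>F\<close> contains \<open>x\<close> and has at least \<open>N\<close> elements. The case
    \<open>x = 0\<close> is treated apart.\<close>
  define F where "F = (\<lambda>k. real k *\<^sub>R x) ` {1..N}"
  have "dist (\<Sum>y\<in>basis \<mu>. act y (ip y x)) x < e" if \<mu>: "finite \<mu>" "F \<subseteq> \<mu>" for \<mu>
  proof (cases "x = 0")
    case True
    then show ?thesis using e sum_act_basis[OF \<mu>(1), of x] by (simp add: app_simps)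
  next
    case False
    have "1 *\<^sub>R x \<in> F" unfolding F_def using N0 by (intro image_eqI[of _ _ 1]) auto
    then have x: "x \<in> \<mu>" using \<mu> by auto
    have "card F = N" using False by (simp add: F_def card_image inj_on_def)
    then have "N \<le> card \<mu>" using card_mono[OF \<mu>] by simp
    then have "1 / e\<^sup>2 < real (card \<mu>)" using N by linarith
    then have c: "1 < real (card \<mu>) * e\<^sup>2" using e by (simp add: field_simps)
    have "(norm (app (resolvent \<mu>) x))\<^sup>2 < e\<^sup>2"
    proof (rule ccontr)
      assume "\<not> ?thesis"
      then have "real (card \<mu>) * e\<^sup>2 \<le> real (card \<mu>) * (norm (app (resolvent \<mu>) x))\<^sup>2"
        by (intro mult_left_mono) auto
      then show False using c norm_app_resolvent_le[OF \<mu>(1) x] by linarith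
    qed
    then have "norm (app (resolvent \<mu>) x) < e" using e by (simp add: power2_less_imp_less)
    then show ?thesis by (simp add: sum_act_basis[OF \<mu>(1)] dist_norm)
  qed
  then show "\<forall>\<^sub>F \<mu> in finite_subsets_at_top UNIV. dist (\<Sum>y\<in>basis \<mu>. act y (ip y x)) x < e"
    unfolding eventually_finite_subsets_at_top by (intro exI[of _ F]) (auto simp: F_def)
qed

end

section \<open>Right modules, and left modules read as right modules\<close>

lemma hilbert_form_generalized_right_basis:
  fixes act :: "'x::cbanach \<Rightarrow> 'a::cstar_algebra \<Rightarrow> 'x"
  assumes "hilbert_form act ip J"
  shows "\<exists>(\<Lambda> :: 'x set) u. generalized_right_basis act ip \<Lambda> u"
proof -
  interpret hilbert_form_cs act ip J
    by (rule hilbert_form.hilbert_form_cs[OF assms])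
  have "(\<Sum>y\<in>basis \<mu>. ip x y * ip y x) \<le>\<^sub>A (\<Sum>y\<in>basis \<nu>. ip x y * ip y x)"
    if "finite \<nu>" "\<mu> \<subseteq> \<nu>" for x \<mu> \<nu>
    using cstar_positive_ip_app[OF resolvent_antimono[OF that], of x] that
    by (simp add: cstar_le_def sum_ip_basis finite_subset app_simps ip_diff_right)
  then have "generalized_right_basis act ip UNIV basis"
    unfolding generalized_right_basis_def
    using tendsto_sum_act_basis card_image[OF inj_on_basis_op] by (auto simp: basis_def)
  then show ?thesis by blast
qed

theorem proposition1p9:
  fixes ract :: "'x::cbanach \<Rightarrow> 'a::cstar_algebra \<Rightarrow> 'x"
    and rip :: "'x \<Rightarrow> 'x \<Rightarrow> 'a"
    and lact :: "'b::cstar_algebra \<Rightarrow> 'y::cbanach \<Rightarrow> 'y"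
    and lip :: "'y \<Rightarrow> 'y \<Rightarrow> 'b"
  shows "(right_hilbert_module ract rip \<longrightarrow>
            (\<exists>(\<Lambda> :: 'x set) u. generalized_right_basis ract rip \<Lambda> u)) \<and>
         (left_hilbert_module lact lip \<longrightarrow>
            (\<exists>(\<Lambda> :: 'y set) u. generalized_left_basis lact lip \<Lambda> u))"
proof (intro conjI impI)
  assume "right_hilbert_module ract rip"
  then interpret right_hilbert_module ract rip .
  have "hilbert_form ract rip (scaleC \<i>)"
    by unfold_locales
      (simp_all add: ip_add_right ip_scaleC_right scaleR_scaleC ip_act_right star_ip ip_positive norm_ip)
  then show "\<exists>(\<Lambda> :: 'x set) u. generalized_right_basis ract rip \<Lambda> u"
    by (rule hilbert_form_generalized_right_basis)
next
  assume "left_hilbert_module lact lip"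
  then interpret left_hilbert_module lact lip .
  have add: "lip x (y + z) = lip x y + lip x z" for x y z
    by (metis star_ip ip_add_left star_add)
  have scale: "lip x (c *\<^sub>C y) = cnj c *\<^sub>C lip x y" for x y c
    by (metis star_ip ip_scaleC_left star_scaleC)
  have act: "lip x (lact (star a) y) = lip x y * a" for x y a
    by (metis star_ip ip_act_left star_mult star_star)
  \<comment> \<open>\<open>lip\<close> is conjugate linear in its second argument, so
    \<open>- \<i>\<close> on the module becomes \<open>\<i>\<close> on the algebra.\<close>
  have "hilbert_form (\<lambda>y a. lact (star a) y) lip (scaleC (- \<i>))"
    by unfold_locales
      (simp_all add: add scale scaleR_scaleC act star_ip ip_positive norm_ip)
  then obtain \<Lambda> :: "'y set" and u where
    "generalized_right_basis (\<lambda>y a. lact (star a) y) lip \<Lambda> u"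
    using hilbert_form_generalized_right_basis by blast
  \<comment> \<open>By \<open>star_ip\<close> the summand \<open>lact (star (lip y x)) y\<close> is
    \<open>lact (lip x y) y\<close>; the other two conditions agree literally.\<close>
  then have "generalized_left_basis lact lip \<Lambda> u"
    by (simp add: generalized_right_basis_def generalized_left_basis_def star_ip)
  then show "\<exists>(\<Lambda> :: 'y set) u. generalized_left_basis lact lip \<Lambda> u" by blast
qed

end
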